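(* Let $(G,c)$ be a plane MOY graph with Alexander polynomial $\Delta_G(t)$, and suppose $\Delta_G(t)\doteq \sum_{i=1}^n a_i t^i$ with $a_1=a_n\neq 0$. Then all the coefficients $a_1,a_2,\dots,a_n$ are positive.
   Context: **Plane MOY graphs.** A plane MOY graph $(G,c)$ is a finite connected directed graph $G$ (loops and multiple edges allowed), embedded in $\mathbb{R}^2$, with (i) a transverse orientation: at each vertex $v$, all edge-ends pointing into $v$ lie on one side of $v$ and all edge-ends pointing out of $v$ lie on the other side, i.e. in the cyclic order around $v$ the incoming ends are consecutive and the outgoing ends are consecutive; (ii) a balanced coloring $c:E\to\mathbb{Z}_{\ge 0}$: at each vertex $v$, the sum of $c(e)$ over edges $e$ pointing into $v$ equals the sum of $c(e)$ over edges $e$ pointing out of $v$. **Crossings, regions, corners.** Draw a small circle around each vertex. For each edge $e$, let $cr(e)$ (a crossing) be the point where $e$, entering its head $v$, meets the circle around $v$; $\operatorname{Cr}(G)$ is the set of crossings. $\operatorname{Re}(G)$ is the set of regions: the regular regions (faces of $G$ in $\mathbb{R}^2$) and one circle region for each vertex (the disk around it). One has $|\operatorname{Re}(G)|=|\operatorname{Cr}(G)|+2$. Around $cr(e)$ there are three corners: the north corner (inside the circle region of the head of $e$), and the west and east corners, lying in the regular regions on the left and on the right of $e$ respectively, when facing in the direction of $e$. Each corner belongs to a unique region. **Kauffman states.** Put a base point $\delta$ on an edge $e_0$ of color $i_0$ that is adjacent to two distinct regular regions $R_u,R_v$ (the marked regions). A Kauffman state is a bijection $s:\operatorname{Cr}(G)\to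 \operatorname{Re}(G)\setminus\{R_u,R_v\}$ sending each crossing to (the region of) one of its corners. $S(G,\delta)$ is the set of Kauffman states. **Alexander polynomial.** Let $[i]=\dfrac{t^{i/2}-t^{-i/2}}{t^{1/2}-t^{-1/2}}$. For a crossing generated by an edge $e\ne e_0$ of color $i$, the local contribution is $[i]$ for the north corner, $t^{-i/2}$ for the west corner and $t^{i/2}$ for the east corner; for $cr(e_0)$ (always assigned to its north corner) it is $t^{i_0/2}$. $P_s(t)$ is the product over all crossings of the local contributions of the corners chosen by $s$, and $\Delta_G(t)=\Delta_{(G,c)}(t)=\sum_{s\in S(G,\delta)}P_s(t)$. It is well defined up to multiplication by a power of $t$ and, up to such a power, independent of $\delta$. **Notation.** $\doteq$ denotes equality up to multiplication by a power $t^{r}$ of $t$ ($r\in\frac12\mathbb{Z}$). *)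

theory Defs
  imports
    "Graph_Theory.Graph_Theory"
    "HOL-Combinatorics.Orbits"
    "HOL-Computational_Algebra.Formal_Laurent_Series"
begin

text \<open>
  A finite connected directed graph, drawn in the oriented plane, is represented by its rotation
  system (combinatorial map): a permutation \<open>rot\<close> of the edge-ends that sends every edge-end to
  the next one counterclockwise around the same vertex. This determines the drawing up to
  orientation-preserving homeomorphism of the sphere. Which of the faces is the unbounded one is
  not recorded: the unbounded face is a regular region like any other, and no notion below
  distinguishes it.
\<close>

datatype 'e edge_end =
    Out 'e  \<comment> \<open>the initial end of an edge, pointing out of its tail\<close>
  | In 'e   \<comment> \<open>the terminal end of an edge, pointing into its head\<close>

fun opposite :: "'e edge_end \<Rightarrow> 'e edge_end" where
  "opposite (Out e) = In e"
| "opposite (In e) = Out e"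

definition in_ends :: "('v, 'e) pre_digraph \<Rightarrow> 'v \<Rightarrow> 'e edge_end set" where
  "in_ends G v = In ` in_arcs G v"

definition out_ends :: "('v, 'e) pre_digraph \<Rightarrow> 'v \<Rightarrow> 'e edge_end set" where
  "out_ends G v = Out ` out_arcs G v"

definition edge_ends :: "('v, 'e) pre_digraph \<Rightarrow> 'e edge_end set" where
  "edge_ends G = In ` arcs G \<union> Out ` arcs G"

definition rotation_system :: "('v, 'e) pre_digraph \<Rightarrow> ('e edge_end \<Rightarrow> 'e edge_end) \<Rightarrow> bool" where
  "rotation_system G rot \<longleftrightarrow>
     rot permutes edge_ends G \<and>
     (\<forall>v\<in>verts G. in_ends G v \<union> out_ends G v \<noteq> {} \<longrightarrow>
        cyclic_on rot (in_ends G v \<union> out_ends G v))"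

text \<open>
  An edge-end \<open>x\<close> also names the angular sector at its vertex that lies between \<open>x\<close> and
  \<open>rot x\<close>, that is, immediately to the left of \<open>x\<close> when one leaves the vertex along \<open>x\<close>.
  The sector \<open>x\<close> is to the right of \<open>rot x\<close>, so, along the edge of \<open>rot x\<close>, it belongs to the
  same face as the sector \<open>opposite (rot x)\<close> at the other end of that edge. The faces are the
  classes of sectors generated by this step. The left-hand face of an edge \<open>e\<close> is hence the one
  containing the sector \<open>Out e\<close>, and the right-hand face the one containing the sector \<open>In e\<close>.
\<close>

definition face_of :: "('e edge_end \<Rightarrow> 'e edge_end) \<Rightarrow> 'e edge_end \<Rightarrow> 'e edge_end set" where
  "face_of rot x = orbit (\<lambda>y. opposite (rot y)) x"

definition faces :: "('v, 'e) pre_digraph \<Rightarrow> ('e edge_end \<Rightarrow> 'e edge_end) \<Rightarrow> 'e edge_end set set" where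
  "faces G rot = face_of rot ` edge_ends G"

text \<open>
  For a connected graph, a rotation system is that of a drawing in the plane (equivalently, the
  sphere) iff its genus is zero, i.e. \<open>V - E + F = 2\<close>. The graph with a single vertex and no edges
  is plane, too; its only face contains no sector, so \<open>faces\<close> misses it. (It carries no base point.)
\<close>

definition genus_zero :: "('v, 'e) pre_digraph \<Rightarrow> ('e edge_end \<Rightarrow> 'e edge_end) \<Rightarrow> bool" where
  "genus_zero G rot \<longleftrightarrow>
     (arcs G \<noteq> {} \<longrightarrow> card (verts G) + card (faces G rot) = card (arcs G) + 2)"

definition consecutive :: "('a \<Rightarrow> 'a) \<Rightarrow> 'a set \<Rightarrow> bool" where
  "consecutive f A \<longleftrightarrow> (\<exists>x n. A = (\<lambda>k. (f ^^ k) x) ` {..<n})"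

locale plane_MOY_graph = fin_digraph G
  for G :: "('v, 'e) pre_digraph" +
  fixes rot :: "'e edge_end \<Rightarrow> 'e edge_end"
    and c :: "'e \<Rightarrow> nat"
  assumes connected_graph: "connected G"
    and rotation: "rotation_system G rot"
    and plane: "genus_zero G rot"
    and transverse_in: "v \<in> verts G \<Longrightarrow> consecutive rot (in_ends G v)"
    and transverse_out: "v \<in> verts G \<Longrightarrow> consecutive rot (out_ends G v)"
    and balanced: "v \<in> verts G \<Longrightarrow> (\<Sum>e\<in>in_arcs G v. c e) = (\<Sum>e\<in>out_arcs G v. c e)"

text \<open>Every edge \<open>e\<close> generates exactly one crossing \<open>cr(e)\<close>; crossings are indexed by edges.\<close>

datatype ('v, 'e) region = Regular "'e edge_end set" | Circle 'v

definition regions ::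
  "('v, 'e) pre_digraph \<Rightarrow> ('e edge_end \<Rightarrow> 'e edge_end) \<Rightarrow> ('v, 'e) region set" where
  "regions G rot = Regular ` faces G rot \<union> Circle ` verts G"

datatype corner = North | West | East

fun corner_region ::
  "('v, 'e) pre_digraph \<Rightarrow> ('e edge_end \<Rightarrow> 'e edge_end) \<Rightarrow> 'e \<Rightarrow> corner \<Rightarrow> ('v, 'e) region" where
  "corner_region G rot e North = Circle (head G e)"
| "corner_region G rot e West = Regular (face_of rot (Out e))"
| "corner_region G rot e East = Regular (face_of rot (In e))"

definition base_edge :: "('v, 'e) pre_digraph \<Rightarrow> ('e edge_end \<Rightarrow> 'e edge_end) \<Rightarrow> 'e \<Rightarrow> bool" where
  "base_edge G rot e0 \<longleftrightarrow>
     e0 \<in> arcs G \<and> corner_region G rot e0 West \<noteq> corner_region G rot e0 East"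

definition marked_regions ::
  "('v, 'e) pre_digraph \<Rightarrow> ('e edge_end \<Rightarrow> 'e edge_end) \<Rightarrow> 'e \<Rightarrow> ('v, 'e) region set" where
  "marked_regions G rot e0 = {corner_region G rot e0 West, corner_region G rot e0 East}"

definition Kauffman_states ::
  "('v, 'e) pre_digraph \<Rightarrow> ('e edge_end \<Rightarrow> 'e edge_end) \<Rightarrow> 'e \<Rightarrow> ('e \<Rightarrow> ('v, 'e) region) set" where
  "Kauffman_states G rot e0 =
     {s \<in> extensional (arcs G).
        bij_betw s (arcs G) (regions G rot - marked_regions G rot e0) \<and>
        (\<forall>e\<in>arcs G. \<exists>k. s e = corner_region G rot e k)}"

text \<open>
  Laurent polynomials in \<open>t\<^sup>1\<^sup>/\<^sup>2\<close> are regarded as formal Laurent series whose variable is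
  \<open>t\<^sup>1\<^sup>/\<^sup>2\<close>; thus \<open>thalf k\<close> is \<open>t\<close> to the power \<open>k/2\<close>.
\<close>

definition thalf :: "int \<Rightarrow> rat fls" where
  "thalf k = fls_X_intpow k"

definition qint :: "nat \<Rightarrow> rat fls" where
  "qint i = (thalf (int i) - thalf (- int i)) / (thalf 1 - thalf (- 1))"

definition contribution :: "('e \<Rightarrow> nat) \<Rightarrow> 'e \<Rightarrow> 'e \<Rightarrow> corner \<Rightarrow> rat fls" where
  "contribution c e0 e k =
     (if e = e0 then thalf (int (c e0))
      else case k of
             North \<Rightarrow> qint (c e)
           | West \<Rightarrow> thalf (- int (c e))
           | East \<Rightarrow> thalf (int (c e)))"

text \<open>
  The corner of \<open>cr(e)\<close> in the region chosen by a state is unique, except when the west and the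
  east corner lie in the same regular region. Then \<open>e\<close> is a bridge of the graph, so it has
  color 0 by the balancing condition, and both corners contribute 1.
\<close>

definition chosen_corner ::
  "('v, 'e) pre_digraph \<Rightarrow> ('e edge_end \<Rightarrow> 'e edge_end) \<Rightarrow> ('e \<Rightarrow> ('v, 'e) region) \<Rightarrow> 'e \<Rightarrow> corner" where
  "chosen_corner G rot s e =
     (if s e = corner_region G rot e North then North
      else if s e = corner_region G rot e West then West
      else East)"

definition state_weight ::
  "('v, 'e) pre_digraph \<Rightarrow> ('e edge_end \<Rightarrow> 'e edge_end) \<Rightarrow> ('e \<Rightarrow> nat) \<Rightarrow> 'e
     \<Rightarrow> ('e \<Rightarrow> ('v, 'e) region) \<Rightarrow> rat fls" where
  "state_weight G rot c e0 s = (\<Prod>e\<in>arcs G. contribution c e0 e (chosen_corner G rot s e))"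

definition Alexander ::
  "('v, 'e) pre_digraph \<Rightarrow> ('e edge_end \<Rightarrow> 'e edge_end) \<Rightarrow> ('e \<Rightarrow> nat) \<Rightarrow> 'e \<Rightarrow> rat fls" where
  "Alexander G rot c e0 = (\<Sum>s\<in>Kauffman_states G rot e0. state_weight G rot c e0 s)"

definition eq_up_to_power :: "rat fls \<Rightarrow> rat fls \<Rightarrow> bool" (infix \<open>\<doteq>\<close> 50) where
  "f \<doteq> g \<longleftrightarrow> (\<exists>m. f = thalf m * g)"

end

theory Submission
  imports Defs
begin

text \<open>
  The Alexander polynomial is a generating function over spanning arborescences. A Kauffman state sends
  exactly one crossing to the circle region of each vertex \<open>v\<close>, so it selects an edge into \<open>v\<close>; at the
  head of the base edge, the root, this is the base edge. By Kauffman's correspondence, the edges selected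
  at the other vertices form a spanning arborescence directed away from the root, and every such
  arborescence comes from a state (\<open>state_arborescence\<close>, \<open>arborescence_state\<close>).

  The coloring is a flow on a plane graph, so there is a height function \<open>h\<close> on the faces that
  increases by \<open>c e\<close> when \<open>e\<close> is crossed from left to right. In terms of \<open>h\<close>, the west and east
  contributions of a state multiply to a power of \<open>t\<close> that is the same for all states, up to factors
  which belong to the selected edges and turn the quantum integer of \<open>e\<close> into the sum of the powers
  \<open>t\<^sup>m\<close> over the levels \<open>m\<close> of \<open>e\<close>, the integers from the height on the left of \<open>e\<close> to that on the
  right, the latter excluded. Up to a power of \<open>t\<close>, the coefficient of \<open>t\<^sup>j\<close> therefore counts
  levelings: an arborescence together with a level of each of its edges, the levels having sum \<open>j\<close>
  (\<open>Alexander_coeff\<close>). In particular no coefficient is negative, and it remains to show that the sums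
  of levels have no gaps.

  The transverse orientation implies that the edges into a vertex, from left to right, have adjacent
  intervals of levels. So a level at a vertex determines the edge, and a leveling is just a function on
  the vertices. The key fact is \<open>exchange\<close>: if two levelings differ, then one can be moved by a single
  level towards the other at some vertex. The right vertex is a deepest one, \<open>v\<close> say, at which they
  differ. Suppose that the edge \<open>f\<close> at the next level starts at a descendant of \<open>v\<close>. Then it closes a
  cycle, which consists of \<open>f\<close> and a path common to both arborescences. This cycle separates the
  plane, and \<open>f\<close> lies between the two edges selected at \<open>v\<close> or coincides with one of them. But both
  are reached from the root by paths that avoid the cycle, a contradiction. By repeated exchange the
  sum of levels passes through all integers between the values for any two levelings, so all
  coefficients between two that are nonzero are positive.

  The topology of the plane enters through three facts about combinatorial maps, which rest on the
  vanishing of flows on trees (\<open>tree_flow_zero\<close>) and on the walk around a tree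
  (\<open>tour_const\<close>): complementary choices of parent edges for vertices and faces
  are trees (\<open>complementary_parents_are_trees\<close>), flows have potentials (\<open>flow_has_potential\<close>), and the
  complement of a spanning tree contains a spanning tree of faces (\<open>tree_has_cotree\<close>).
\<close>

section \<open>Trees and flows in a system of darts\<close>

text \<open>
  Sectors and edge-ends are both called darts: a dart stands for itself and for the sector between
  it and its \<open>turn\<close>. The cells are the cycles of \<open>turn\<close>, labelled by the function \<open>cell\<close>, and \<open>flip\<close>
  goes to the other end of an edge. With \<open>turn\<close> the rotation, the cells are the vertices; with
  \<open>flip \<circ> turn\<close> in its place they are the faces. The lemmas below are applied in both readings,
  which makes planar duality a matter of instantiation.
\<close>

locale dart_system =
  fixes D :: "'d set" and turn flip :: "'d \<Rightarrow> 'd" and cell :: "'d \<Rightarrow> 'k"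
  assumes finite_D: "finite D"
    and turn_bij: "bij_betw turn D D"
    and flip_in: "x \<in> D \<Longrightarrow> flip x \<in> D"
    and flip_flip: "flip (flip x) = x"
    and cell_eq_iff: "x \<in> D \<Longrightarrow> y \<in> D \<Longrightarrow> cell x = cell y \<longleftrightarrow> (\<exists>n. y = (turn ^^ n) x)"
begin

lemma turn_in: "x \<in> D \<Longrightarrow> turn x \<in> D"
  using turn_bij by (auto simp: bij_betw_def)

lemma cell_turn: "x \<in> D \<Longrightarrow> cell (turn x) = cell x"
proof -
  assume "x \<in> D"
  moreover have "turn x = (turn ^^ 1) x" by simp
  ultimately show ?thesis using cell_eq_iff[of x "turn x"] turn_in by metis
qed

lemma turn_surj:
  assumes "y \<in> D"
  obtains x where "x \<in> D" "turn x = y"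
  using assms turn_bij by (metis bij_betw_imp_surj_on imageE)

lemma sum_turn:
  fixes f :: "'d \<Rightarrow> int"
  shows "(\<Sum>x\<in>{x \<in> D. cell x = k}. f (turn x)) = (\<Sum>x\<in>{x \<in> D. cell x = k}. f x)"
proof (rule sum.reindex_bij_betw)
  show "bij_betw turn {x \<in> D. cell x = k} {x \<in> D. cell x = k}"
  proof (rule bij_betw_imageI)
    show "inj_on turn {x \<in> D. cell x = k}"
      using turn_bij by (auto simp: bij_betw_def inj_on_def)
    show "turn ` {x \<in> D. cell x = k} = {x \<in> D. cell x = k}"
    proof (rule set_eqI, rule iffI)
      fix y assume "y \<in> turn ` {x \<in> D. cell x = k}"
      then show "y \<in> {x \<in> D. cell x = k}" using cell_turn turn_in by auto
    next
      fix y assume y: "y \<in> {x \<in> D. cell x = k}"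
      then obtain x where "x \<in> D" "turn x = y" using turn_surj by blast
      then show "y \<in> turn ` {x \<in> D. cell x = k}" using y cell_turn by auto
    qed
  qed
qed

text \<open>
  Since a cell is a single cycle, local invariance under \<open>turn\<close> is invariance on the whole cell.
\<close>

lemma eq_on_cell:
  assumes step: "\<And>y. y \<in> D \<Longrightarrow> cell y = k \<Longrightarrow> f (turn y) = f y"
    and "x \<in> D" "cell x = k" "y \<in> D" "cell y = k"
  shows "f y = f x"
proof -
  obtain n where n: "y = (turn ^^ n) x" using assms cell_eq_iff by metis
  have "(turn ^^ m) x \<in> D \<and> cell ((turn ^^ m) x) = k \<and> f ((turn ^^ m) x) = f x" for m
  proof (induction m)
    case (Suc m)
    then show ?case using turn_in[of "(turn ^^ m) x"] cell_turn[of "(turn ^^ m) x"] step by simp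
  qed (use assms in auto)
  then show ?thesis using n by blast
qed

end

definition parent_darts :: "('d \<Rightarrow> 'd) \<Rightarrow> ('k \<Rightarrow> 'd) \<Rightarrow> 'k set \<Rightarrow> 'd set" where
  "parent_darts flip parent A = parent ` A \<union> (\<lambda>k. flip (parent k)) ` A"

lemma (in dart_system) flip_parent_darts: "flip x \<in> parent_darts flip p A \<longleftrightarrow> x \<in> parent_darts flip p A"
proof -
  have "flip x \<in> parent_darts flip p A" if "x \<in> parent_darts flip p A" for x
    using that flip_flip unfolding parent_darts_def by force
  from this[of x] this[of "flip x"] show ?thesis by (auto simp: flip_flip)
qed

text \<open>
  A tree on the set \<open>Q\<close> of cells is given by the dart that leads from each cell to its parent; the
  depth certifies that there are no cycles. The set \<open>Q\<close> may leave out some cells, because the trees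
  at hand are first known only as the set of cells that are attached to the root.
\<close>

locale rooted_tree = dart_system D turn flip cell
  for D :: "'d set" and turn flip :: "'d \<Rightarrow> 'd" and cell :: "'d \<Rightarrow> 'k" +
  fixes Q :: "'k set" and root :: 'k and parent :: "'k \<Rightarrow> 'd" and depth :: "'k \<Rightarrow> nat"
  assumes root_in: "root \<in> Q"
    and parent: "k \<in> Q - {root} \<Longrightarrow>
      parent k \<in> D \<and> cell (parent k) = k \<and> cell (flip (parent k)) \<in> Q \<and> depth (cell (flip (parent k))) < depth k"
begin

abbreviation tree_darts :: "'d set" where
  "tree_darts \<equiv> parent_darts flip parent (Q - {root})"

text \<open>
  A flow that lives on the edges of a tree vanishes: at a deepest cell whose parent edge carries
  flow, no other edge carries any, which violates conservation there.
\<close>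

lemma tree_flow_zero:
  fixes u :: "'d \<Rightarrow> int"
  assumes antisym: "\<And>k. k \<in> Q - {root} \<Longrightarrow> u (flip (parent k)) = - u (parent k)"
    and off: "\<And>x. x \<in> D \<Longrightarrow> cell x \<in> Q \<Longrightarrow> x \<notin> tree_darts \<Longrightarrow> u x = 0"
    and conservation: "\<And>k. k \<in> Q - {root} \<Longrightarrow> (\<Sum>x\<in>{x \<in> D. cell x = k}. u x) = 0"
    and x: "x \<in> tree_darts"
  shows "u x = 0"
proof -
  obtain B where B: "\<And>k. k \<in> cell ` D \<Longrightarrow> depth k \<le> B"
    using finite_D by (metis Max_ge finite_imageI image_eqI)
  have main: "u (parent k) = 0" if "k \<in> Q - {root}" for k
    using that
  proof (induction "B - depth k" arbitrary: k rule: less_induct)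
    case less
    note pk = parent[OF less.prems]
    have "u x = 0" if x: "x \<in> {x \<in> D. cell x = k} - {parent k}" for x
    proof (cases "x \<in> tree_darts")
      case False
      then show ?thesis using off x less.prems by auto
    next
      case True
      moreover have "x \<notin> parent ` (Q - {root})" using x parent by fastforce
      ultimately obtain k' where k': "k' \<in> Q - {root}" "x = flip (parent k')"
        unfolding parent_darts_def by auto
      then have "depth k < depth k'" "parent k' \<in> D" "cell (parent k') = k'" using parent[OF k'(1)] x by auto
      then have "depth k < depth k'" "k' \<in> cell ` D" by (auto simp: image_iff) metis
      then have "B - depth k' < B - depth k" using B by (metis diff_less_mono2 order_less_le_trans)
      then show ?thesis using less.hyps[OF _ k'(1)] antisym[OF k'(1)] k'(2) by simp
    qed
    then have "(\<Sum>x\<in>{x \<in> D. cell x = k} - {parent k}. u x) = 0" by (simp add: sum.neutral)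
    moreover have "(\<Sum>x\<in>{x \<in> D. cell x = k}. u x)
        = u (parent k) + (\<Sum>x\<in>{x \<in> D. cell x = k} - {parent k}. u x)"
      using pk finite_D by (subst sum.remove[of _ "parent k"]) auto
    ultimately show ?case using conservation[OF less.prems] by simp
  qed
  then show ?thesis using x antisym unfolding parent_darts_def by auto
qed

text \<open>
  The map in the first assumption is the walk around the tree: it follows a tree edge along its side
  and crosses every other edge. The walk visits all sectors at the cells of a tree, so a property
  that it preserves holds at all of them or at none. Instead of following the walk, compare the
  values of the invariant on the two sides of each tree edge: their difference is a flow on the tree,
  so it is zero.
\<close>

lemma tour_const:
  assumes inv: "\<And>y. y \<in> D \<Longrightarrow> cell y \<in> Q \<Longrightarrow>
      P (if turn y \<in> tree_darts then flip (turn y) else turn y) \<longleftrightarrow> P y"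
    and "x \<in> D" "cell x = root" "y \<in> D" "cell y \<in> Q"
  shows "P y \<longleftrightarrow> P x"
proof -
  define f :: "'d \<Rightarrow> int" where "f x = of_bool (P x)" for x
  define u where "u x = (if x \<in> tree_darts then f (flip x) - f x else 0)" for x
  \<comment> \<open>The sector before a tree dart has the value of the flipped dart, by invariance.\<close>
  have u_turn: "u (turn y) = f y - f (turn y)" if "y \<in> D" "cell y \<in> Q" for y
    using inv[OF that] unfolding u_def f_def by (auto split: if_splits)
  have u0: "u x = 0" if "x \<in> tree_darts" for x
  proof (rule tree_flow_zero[OF _ _ _ that])
    fix k assume "k \<in> Q - {root}"
    then show "u (flip (parent k)) = - u (parent k)"
      using flip_flip unfolding u_def parent_darts_def by auto
  next
    fix k assume k: "k \<in> Q - {root}"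
    have "(\<Sum>x\<in>{x \<in> D. cell x = k}. u x) = (\<Sum>x\<in>{x \<in> D. cell x = k}. u (turn x))"
      by (simp add: sum_turn)
    also have "\<dots> = (\<Sum>x\<in>{x \<in> D. cell x = k}. f x - f (turn x))"
      using u_turn k by (intro sum.cong) auto
    also have "\<dots> = 0" by (simp add: sum_subtractf sum_turn)
    finally show "(\<Sum>x\<in>{x \<in> D. cell x = k}. u x) = 0" .
  qed (simp add: u_def)
  have turn_eq: "f (turn y) = f y" if "y \<in> D" "cell y \<in> Q" for y
    using u_turn[OF that] u0[of "turn y"] by (cases "turn y \<in> tree_darts") (auto simp: u_def)
  have cell_const: "f y = f x" if "x \<in> D" "y \<in> D" "cell x = cell y" "cell x \<in> Q" for x y
    by (rule eq_on_cell[of "cell x"]) (use that turn_eq in auto)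
  have main: "f y = f x" if "y \<in> D" "cell y \<in> Q" for y
    using that
  proof (induction "depth (cell y)" arbitrary: y rule: less_induct)
    case less
    show ?case
    proof (cases "cell y = root")
      case True
      then show ?thesis using cell_const less.prems assms(2,3) by metis
    next
      case False
      then have k: "cell y \<in> Q - {root}" using less.prems by auto
      note p = parent[OF k]
      have "f y = f (parent (cell y))" using cell_const p less.prems by metis
      also have "parent (cell y) \<in> tree_darts" using k unfolding parent_darts_def by blast
      then have "f (parent (cell y)) = f (flip (parent (cell y)))" using u0 unfolding u_def by force
      also have "\<dots> = f x" using less.hyps[of "flip (parent (cell y))"] p flip_in by auto
      finally show ?thesis .
    qed
  qed
  show ?thesis using main[OF assms(4,5)] unfolding f_def of_bool_eq_iff .
qed

end

text \<open>
  The elements from which a root can be reached by steps of a relation, with the distance as depth.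
\<close>

lemma basin:
  fixes R :: "('k \<times> 'k) set" and root :: 'k
  shows "\<exists>Q (depth :: 'k \<Rightarrow> nat). root \<in> Q
    \<and> (\<forall>k\<in>Q - {root}. \<exists>k'\<in>Q. (k, k') \<in> R \<and> depth k' < depth k)
    \<and> (\<forall>k k'. (k, k') \<in> R \<longrightarrow> k' \<in> Q \<longrightarrow> k \<in> Q)"
proof -
  define Q where "Q = {k. \<exists>n. (k, root) \<in> R ^^ n}"
  define depth where "depth k = (LEAST n. (k, root) \<in> R ^^ n)" for k
  have "\<exists>n. (root, root) \<in> R ^^ n" by (rule exI[of _ 0]) simp
  then have 1: "root \<in> Q" by (simp add: Q_def)
  have 2: "\<exists>k'\<in>Q. (k, k') \<in> R \<and> depth k' < depth k" if k: "k \<in> Q - {root}" for k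
  proof -
    have L: "(k, root) \<in> R ^^ depth k"
      using k LeastI_ex[of "\<lambda>n. (k, root) \<in> R ^^ n"] by (simp add: Q_def depth_def)
    then obtain m where m: "depth k = Suc m" using k by (cases "depth k") auto
    then have "(k, root) \<in> R O (R ^^ m)" using L by (metis relpow.simps(2) relpow_commute)
    then obtain k' where k': "(k, k') \<in> R" "(k', root) \<in> R ^^ m" by auto
    then have "depth k' \<le> m" unfolding depth_def by (intro Least_le)
    then show ?thesis using k' m unfolding Q_def by auto
  qed
  have 3: "k \<in> Q" if "(k, k') \<in> R" "k' \<in> Q" for k k'
  proof -
    obtain n where "(k', root) \<in> R ^^ n" using \<open>k' \<in> Q\<close> unfolding Q_def by blast
    then have "(k, root) \<in> R O R ^^ n" using that by auto
    then have "(k, root) \<in> R ^^ Suc n" by (metis relpow.simps(2) relpow_commute)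
    then show ?thesis unfolding Q_def by blast
  qed
  show ?thesis using 1 2 3 by (intro exI[of _ Q] exI[of _ depth]) blast
qed

section \<open>Trees and complementary trees on a surface\<close>

locale surface_map =
  dart_system D turn flip cell + dual: dart_system D "\<lambda>x. flip (turn x)" flip face
  for D :: "'d set" and turn flip :: "'d \<Rightarrow> 'd" and cell :: "'d \<Rightarrow> 'k" and face :: "'d \<Rightarrow> 'f" +
  assumes connected: "X \<subseteq> D \<Longrightarrow> X \<noteq> {} \<Longrightarrow> (\<And>x. x \<in> X \<Longrightarrow> turn x \<in> X) \<Longrightarrow> (\<And>x. x \<in> X \<Longrightarrow> flip x \<in> X)
    \<Longrightarrow> X = D"
begin

lemma dual_map: "surface_map D (\<lambda>x. flip (turn x)) flip face cell"
proof -
  have *: "(\<lambda>x. flip (flip (turn x))) = turn" using flip_flip by auto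
  have "dart_system D (\<lambda>x. flip (flip (turn x))) flip cell"
    unfolding * by (rule dart_system_axioms)
  moreover have "X = D" if X: "X \<subseteq> D" "X \<noteq> {}" "\<And>x. x \<in> X \<Longrightarrow> flip (turn x) \<in> X"
    "\<And>x. x \<in> X \<Longrightarrow> flip x \<in> X" for X
  proof (rule connected[OF X(1,2) _ X(4)])
    show "turn x \<in> X" if "x \<in> X" for x
      using X(4)[OF X(3)[OF that]] by (simp add: flip_flip)
  qed
  ultimately show ?thesis
    by (intro surface_map.intro surface_map_axioms.intro dual.dart_system_axioms) blast+
qed

lemma face_flip_turn: "y \<in> D \<Longrightarrow> face (flip (turn y)) = face y"
  by (rule dual.cell_turn)

text \<open>
  If a set of faces is closed under crossing all edges outside a tree, then the walk around the tree
  never leaves it.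
\<close>

lemma faces_around_tree:
  assumes tree: "rooted_tree D turn flip cell Q (cell x) parent depth"
    and cross: "\<And>y. y \<in> D \<Longrightarrow> cell y \<in> Q \<Longrightarrow> y \<notin> parent_darts flip parent (Q - {cell x}) \<Longrightarrow> face (flip y) \<in> S \<longleftrightarrow> face y \<in> S"
    and "x \<in> D" "face x \<in> S" "y \<in> D" "cell y \<in> Q"
  shows "face y \<in> S"
proof -
  interpret rooted_tree D turn flip cell Q "cell x" parent depth by fact
  have "face y \<in> S \<longleftrightarrow> face x \<in> S"
  proof (rule tour_const)
    fix y assume y: "y \<in> D" "cell y \<in> Q"
    show "(face (if turn y \<in> tree_darts then flip (turn y) else turn y) \<in> S) = (face y \<in> S)"
      using face_flip_turn[OF y(1)] cross[OF turn_in[OF y(1)]] cell_turn[OF y(1)] y(2) by auto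
  qed (use assms in auto)
  then show ?thesis using assms by simp
qed

lemma basin_of_parents:
  fixes root :: 'k
  assumes root: "root \<in> cell ` D"
    and parent: "\<And>k. k \<in> cell ` D - {root} \<Longrightarrow> parent k \<in> D \<and> cell (parent k) = k"
  obtains Q depth where "rooted_tree D turn flip cell Q root parent depth" "Q \<subseteq> cell ` D"
    "\<And>y. y \<in> parent_darts flip parent (cell ` D - {root}) \<Longrightarrow> cell (flip y) \<in> Q \<longleftrightarrow> cell y \<in> Q"
    "\<And>y. y \<in> D \<Longrightarrow> cell y \<in> Q \<Longrightarrow> y \<in> parent_darts flip parent (cell ` D - {root}) \<Longrightarrow>
      y \<in> parent_darts flip parent (Q - {root})"
proof -
  define R where "R = {(k, cell (flip (parent k))) | k. k \<in> cell ` D - {root}}"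
  obtain Q and depth :: "'k \<Rightarrow> nat" where Q: "root \<in> Q"
    "\<forall>k\<in>Q - {root}. \<exists>k'\<in>Q. (k, k') \<in> R \<and> depth k' < depth k"
    "\<forall>k k'. (k, k') \<in> R \<longrightarrow> k' \<in> Q \<longrightarrow> k \<in> Q"
    using basin[of root R] by blast
  have up: "k \<in> cell ` D" "cell (flip (parent k)) \<in> Q" "depth (cell (flip (parent k))) < depth k"
    if "k \<in> Q - {root}" for k
    using Q(2) that unfolding R_def by auto
  have down: "k \<in> Q" if "k \<in> cell ` D - {root}" "cell (flip (parent k)) \<in> Q" for k
    using Q(3) that unfolding R_def by blast
  have sub: "Q \<subseteq> cell ` D" using up(1) root by blast
  show ?thesis
  proof (rule that[OF _ sub])
    show "rooted_tree D turn flip cell Q root parent depth"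
      by unfold_locales (use Q(1) up parent in blast)+
  next
    fix y assume "y \<in> parent_darts flip parent (cell ` D - {root})"
    then obtain k where k: "k \<in> cell ` D - {root}" "y = parent k \<or> y = flip (parent k)"
      unfolding parent_darts_def by auto
    then show "cell (flip y) \<in> Q \<longleftrightarrow> cell y \<in> Q"
      using up(2)[of k] down[of k] parent[OF k(1)] flip_flip k(1) by auto
  next
    fix y assume "cell y \<in> Q" "y \<in> parent_darts flip parent (cell ` D - {root})"
    then obtain k where k: "k \<in> cell ` D - {root}" "y = parent k \<or> y = flip (parent k)"
      unfolding parent_darts_def by auto
    then have "k \<in> Q - {root}" using \<open>cell y \<in> Q\<close> down parent[OF k(1)] by auto
    then show "y \<in> parent_darts flip parent (Q - {root})" using k unfolding parent_darts_def by auto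
  qed
qed

text \<open>
  The combinatorial core of Kauffman's correspondence between states and trees. Let each cell other
  than that of \<open>x\<close> choose an edge, and each face other than that of \<open>x\<close> choose an edge, so that every
  edge is chosen. A priori both choices could contain cycles. Let \<open>Q\<close> and \<open>Q'\<close> be the cells
  and the faces that are joined to the root by the chosen edges. These are trees, and the walk around
  the first one, which starts at the common sector \<open>x\<close>, crosses only edges that were chosen by faces. It
  therefore stays in faces of \<open>Q'\<close>, and it visits all sectors at \<open>Q\<close>. Dually, all sectors in
  faces of \<open>Q'\<close> belong to cells of \<open>Q\<close>. The sectors at \<open>Q\<close> are hence closed under
  turning and flipping, and by connectedness there are no others.
\<close>

lemma complementary_parents_are_trees:
  assumes x: "x \<in> D"
    and parent: "\<And>k. k \<in> cell ` D - {cell x} \<Longrightarrow> parent k \<in> D \<and> cell (parent k) = k"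
    and coparent: "\<And>f. f \<in> face ` D - {face x} \<Longrightarrow> coparent f \<in> D \<and> face (coparent f) = f"
    and cover: "D \<subseteq> parent_darts flip parent (cell ` D - {cell x}) \<union> parent_darts flip coparent (face ` D - {face x})"
  obtains depth codepth where
    "rooted_tree D turn flip cell (cell ` D) (cell x) parent depth"
    "rooted_tree D (\<lambda>x. flip (turn x)) flip face (face ` D) (face x) coparent codepth"
proof -
  interpret dm: surface_map D "\<lambda>x. flip (turn x)" flip face cell by (rule dual_map)
  obtain Q depth where Q: "rooted_tree D turn flip cell Q (cell x) parent depth" "Q \<subseteq> cell ` D"
    "\<And>y. y \<in> parent_darts flip parent (cell ` D - {cell x}) \<Longrightarrow> cell (flip y) \<in> Q \<longleftrightarrow> cell y \<in> Q"
    "\<And>y. y \<in> D \<Longrightarrow> cell y \<in> Q \<Longrightarrow> y \<in> parent_darts flip parent (cell ` D - {cell x}) \<Longrightarrow>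
      y \<in> parent_darts flip parent (Q - {cell x})"
    using basin_of_parents[of "cell x" parent] x parent by blast
  obtain Q' codepth where Q': "rooted_tree D (\<lambda>x. flip (turn x)) flip face Q' (face x) coparent codepth" "Q' \<subseteq> face ` D"
    "\<And>y. y \<in> parent_darts flip coparent (face ` D - {face x}) \<Longrightarrow> face (flip y) \<in> Q' \<longleftrightarrow> face y \<in> Q'"
    "\<And>y. y \<in> D \<Longrightarrow> face y \<in> Q' \<Longrightarrow> y \<in> parent_darts flip coparent (face ` D - {face x}) \<Longrightarrow>
      y \<in> parent_darts flip coparent (Q' - {face x})"
    using dm.basin_of_parents[of "face x" coparent] x coparent by blast
  interpret t: rooted_tree D turn flip cell Q "cell x" parent depth by fact
  interpret t': rooted_tree D "\<lambda>x. flip (turn x)" flip face Q' "face x" coparent codepth by fact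
  have 1: "face y \<in> Q'" if "y \<in> D" "cell y \<in> Q" for y
  proof (rule faces_around_tree[OF Q(1) _ x t'.root_in that])
    fix y assume "y \<in> D" "cell y \<in> Q" "y \<notin> parent_darts flip parent (Q - {cell x})"
    then have "y \<in> parent_darts flip coparent (face ` D - {face x})" using Q(4) cover by blast
    then show "face (flip y) \<in> Q' \<longleftrightarrow> face y \<in> Q'" by (rule Q'(3))
  qed
  have 2: "cell y \<in> Q" if "y \<in> D" "face y \<in> Q'" for y
  proof (rule dm.faces_around_tree[OF Q'(1) _ x t.root_in that])
    fix y assume "y \<in> D" "face y \<in> Q'" "y \<notin> parent_darts flip coparent (Q' - {face x})"
    then have "y \<in> parent_darts flip parent (cell ` D - {cell x})" using Q'(4) cover by blast
    then show "cell (flip y) \<in> Q \<longleftrightarrow> cell y \<in> Q" by (rule Q(3))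
  qed
  let ?X = "{y \<in> D. cell y \<in> Q}"
  have "?X = D"
  proof (rule connected)
    show "?X \<noteq> {}" using x t.root_in by blast
    show turn: "turn y \<in> ?X" if "y \<in> ?X" for y using that turn_in cell_turn by auto
    show "flip y \<in> ?X" if y: "y \<in> ?X" for y
    proof -
      obtain z where z: "z \<in> D" "turn z = y" using turn_surj y by blast
      then have "cell z \<in> Q" using y cell_turn by auto
      then have "face (flip y) \<in> Q'" using 1 face_flip_turn z by metis
      then show ?thesis using 2 y flip_in by blast
    qed
  qed blast
  then have "Q = cell ` D" "Q' = face ` D" using 1 Q(2) Q'(2) by auto
  then show ?thesis using that[of depth codepth] Q(1) Q'(1) by simp
qed

text \<open>
  On the sphere a flow is the difference of a function on the faces. In the presence of a tree and a
  complementary tree of faces this is explicit: prescribe the difference across the edges of the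
  tree of faces, which determines the function \<open>\<phi>\<close> recursively; the remaining discrepancy is a flow on
  the primal tree, which vanishes.
\<close>

lemma flow_has_potential:
  fixes u :: "'d \<Rightarrow> int" and root :: 'k
  assumes tree: "rooted_tree D turn flip cell (cell ` D) root parent depth"
    and cotree: "rooted_tree D (\<lambda>x. flip (turn x)) flip face (face ` D) coroot coparent codepth"
    and cover: "D \<subseteq> parent_darts flip parent (cell ` D - {root}) \<union> parent_darts flip coparent (face ` D - {coroot})"
    and antisym: "\<And>x. x \<in> D \<Longrightarrow> u (flip x) = - u x"
    and conservation: "\<And>k. k \<in> cell ` D \<Longrightarrow> (\<Sum>x\<in>{x \<in> D. cell x = k}. u x) = 0"
  shows "\<exists>\<phi>. \<forall>x\<in>D. u x = \<phi> (face (flip x)) - \<phi> (face x)"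
proof -
  interpret t: rooted_tree D turn flip cell "cell ` D" root parent depth by fact
  interpret t': rooted_tree D "\<lambda>x. flip (turn x)" flip face "face ` D" coroot coparent codepth by fact
  define F where "F g f = (if f \<in> face ` D - {coroot} then g (face (flip (coparent f))) - u (coparent f) else 0)"
    for g :: "'f \<Rightarrow> int" and f
  define \<phi> where "\<phi> = wfrec (measure codepth) F"
  have rec: "\<phi> f = \<phi> (face (flip (coparent f))) - u (coparent f)" if f: "f \<in> face ` D - {coroot}" for f
    using def_wfrec[OF eq_reflection[OF \<phi>_def] wf_measure, of f] f t'.parent[OF f]
    by (simp add: F_def cut_def)
  define w where "w x = u x - (\<phi> (face (flip x)) - \<phi> (face x))" for x
  have anti: "w (flip x) = - w x" if "x \<in> D" for x
    using antisym[OF that] flip_flip by (simp add: w_def)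
  have off: "w x = 0" if x: "x \<in> D" "x \<notin> t.tree_darts" for x
  proof -
    have "x \<in> t'.tree_darts" using x cover by blast
    then obtain f where f: "f \<in> face ` D - {coroot}" "x = coparent f \<or> x = flip (coparent f)"
      unfolding parent_darts_def by auto
    have "w (coparent f) = 0" using rec[OF f(1)] t'.parent[OF f(1)] by (simp add: w_def)
    then show ?thesis using f(2) anti[of "coparent f"] t'.parent[OF f(1)] by auto
  qed
  have cons: "(\<Sum>x\<in>{x \<in> D. cell x = k}. w x) = 0" if "k \<in> cell ` D" for k
  proof -
    let ?A = "{x \<in> D. cell x = k}"
    have "(\<Sum>x\<in>?A. \<phi> (face (flip x)) - \<phi> (face x))
        = (\<Sum>x\<in>?A. \<phi> (face (flip (turn x))) - \<phi> (face (turn x)))"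
      by (rule sum_turn[symmetric])
    also have "\<dots> = (\<Sum>x\<in>?A. \<phi> (face x) - \<phi> (face (turn x)))"
      by (intro sum.cong) (auto simp: face_flip_turn)
    also have "\<dots> = 0" using sum_turn[of "\<lambda>x. \<phi> (face x)" k] by (simp add: sum_subtractf)
    finally show ?thesis using conservation[OF that] by (simp add: w_def sum_subtractf)
  qed
  have "w x = 0" if "x \<in> D" for x
  proof (cases "x \<in> t.tree_darts")
    case True
    show ?thesis
    proof (rule t.tree_flow_zero[OF _ _ _ True])
      show "w (flip (parent k)) = - w (parent k)" if "k \<in> cell ` D - {root}" for k
        using anti t.parent[OF that] by blast
      show "w y = 0" if "y \<in> D" "y \<notin> t.tree_darts" for y using off[OF that] .
      show "(\<Sum>y\<in>{y \<in> D. cell y = k}. w y) = 0" if "k \<in> cell ` D - {root}" for k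
        using cons that by blast
    qed
  qed (rule off[OF that])
  then have "\<forall>x\<in>D. u x = \<phi> (face (flip x)) - \<phi> (face x)" by (simp add: w_def)
  then show ?thesis by blast
qed

text \<open>
  The edges outside a spanning tree connect all faces, by the walk around the tree, so distances to
  one face yield a tree of faces that avoids the given tree.
\<close>

lemma tree_has_cotree:
  assumes tree: "rooted_tree D turn flip cell (cell ` D) (cell x) parent depth"
    and x: "x \<in> D"
  obtains coparent codepth where
    "rooted_tree D (\<lambda>x. flip (turn x)) flip face (face ` D) (face x) coparent codepth"
    "\<And>f. f \<in> face ` D - {face x} \<Longrightarrow> coparent f \<notin> parent_darts flip parent (cell ` D - {cell x})"
proof -
  interpret t: rooted_tree D turn flip cell "cell ` D" "cell x" parent depth by fact
  define R where "R = {(face y, face (flip y)) | y. y \<in> D \<and> y \<notin> t.tree_darts}"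
  obtain Q and codepth :: "'f \<Rightarrow> nat" where Q: "face x \<in> Q"
    "\<forall>f\<in>Q - {face x}. \<exists>f'\<in>Q. (f, f') \<in> R \<and> codepth f' < codepth f"
    "\<forall>f f'. (f, f') \<in> R \<longrightarrow> f' \<in> Q \<longrightarrow> f \<in> Q"
    using basin[of "face x" R] by blast
  have all: "face y \<in> Q" if "y \<in> D" for y
  proof (rule faces_around_tree[OF tree _ x Q(1) that])
    show "cell y \<in> cell ` D" using that by blast
    fix y assume y: "y \<in> D" "y \<notin> t.tree_darts"
    then have "flip y \<notin> t.tree_darts" by (simp add: flip_parent_darts)
    then have "(face y, face (flip y)) \<in> R" "(face (flip y), face y) \<in> R"
      unfolding R_def using y flip_in[of y] flip_flip[of y] by (blast, force)
    then show "face (flip y) \<in> Q \<longleftrightarrow> face y \<in> Q" using Q(3) by blast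
  qed
  have "\<exists>y. y \<in> D \<and> y \<notin> t.tree_darts \<and> face y = f \<and> codepth (face (flip y)) < codepth f"
    if f: "f \<in> face ` D - {face x}" for f
  proof -
    have "f \<in> Q - {face x}" using f all by blast
    then obtain f' where "(f, f') \<in> R" "codepth f' < codepth f" using Q(2) by blast
    then show ?thesis unfolding R_def by blast
  qed
  note ex = this
  define coparent where
    "coparent f = (SOME y. y \<in> D \<and> y \<notin> t.tree_darts \<and> face y = f \<and> codepth (face (flip y)) < codepth f)" for f
  have coparent: "coparent f \<in> D \<and> coparent f \<notin> t.tree_darts \<and> face (coparent f) = f \<and> codepth (face (flip (coparent f))) < codepth f"
    if "f \<in> face ` D - {face x}" for f
    unfolding coparent_def by (rule someI_ex[OF ex[OF that]])
  show ?thesis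
  proof (rule that)
    show "rooted_tree D (\<lambda>x. flip (turn x)) flip face (face ` D) (face x) coparent codepth"
      by unfold_locales (use x coparent flip_in in blast)+
    show "coparent f \<notin> t.tree_darts" if "f \<in> face ` D - {face x}" for f using coparent[OF that] by blast
  qed
qed

end

section \<open>The rotation system of a plane graph\<close>

fun end_vertex :: "('v, 'e) pre_digraph \<Rightarrow> 'e edge_end \<Rightarrow> 'v" where
  "end_vertex G (Out e) = tail G e"
| "end_vertex G (In e) = head G e"

lemma opposite_opposite [simp]: "opposite (opposite x) = x"
  by (cases x) auto

context plane_MOY_graph
begin

abbreviation darts :: "'e edge_end set" where "darts \<equiv> edge_ends G"
abbreviation left_face :: "'e \<Rightarrow> 'e edge_end set" where "left_face e \<equiv> face_of rot (Out e)"
abbreviation right_face :: "'e \<Rightarrow> 'e edge_end set" where "right_face e \<equiv> face_of rot (In e)"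

lemma finite_darts: "finite darts"
  unfolding edge_ends_def by simp

lemma In_darts [simp]: "In e \<in> darts \<longleftrightarrow> e \<in> arcs G"
  and Out_darts [simp]: "Out e \<in> darts \<longleftrightarrow> e \<in> arcs G"
  unfolding edge_ends_def by auto

lemma opposite_darts: "x \<in> darts \<Longrightarrow> opposite x \<in> darts"
  by (cases x) auto

lemma end_vertex_in_verts: "x \<in> darts \<Longrightarrow> end_vertex G x \<in> verts G"
  by (cases x) auto

lemma darts_at: "in_ends G v \<union> out_ends G v = {x \<in> darts. end_vertex G x = v}"
proof (rule set_eqI)
  fix x show "x \<in> in_ends G v \<union> out_ends G v \<longleftrightarrow> x \<in> {x \<in> darts. end_vertex G x = v}"
    by (cases x) (auto simp: in_ends_def out_ends_def)
qed

lemma rot_permutes: "rot permutes darts"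
  using rotation by (simp add: rotation_system_def)

lemma rot_eq_iff:
  assumes "x \<in> darts" "y \<in> darts"
  shows "end_vertex G x = end_vertex G y \<longleftrightarrow> (\<exists>n. y = (rot ^^ n) x)"
proof -
  let ?A = "{z \<in> darts. end_vertex G z = end_vertex G x}"
  have "cyclic_on rot (in_ends G v \<union> out_ends G v)" if "v \<in> verts G" "in_ends G v \<union> out_ends G v \<noteq> {}" for v
    using rotation that unfolding rotation_system_def by blast
  then have "cyclic_on rot ?A"
    using assms(1) end_vertex_in_verts[OF assms(1)] unfolding darts_at by blast
  then have orb: "?A = orbit rot x" using assms(1) by (simp add: cyclic_on_alldef)
  have "(\<exists>n. y = (rot ^^ n) x) \<longleftrightarrow> y \<in> orbit rot x"
  proof
    assume "\<exists>n. y = (rot ^^ n) x"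
    then obtain n where n: "y = (rot ^^ n) x" by blast
    show "y \<in> orbit rot x"
    proof (cases "n = 0")
      case True
      then show ?thesis using n orb assms(1) by auto
    next
      case False
      then show ?thesis using n by (auto simp: orbit_altdef)
    qed
  qed (auto simp: orbit_altdef)
  moreover have "y \<in> orbit rot x \<longleftrightarrow> end_vertex G y = end_vertex G x"
    using assms(2) by (simp flip: orb)
  ultimately show ?thesis by auto
qed

lemma face_step_bij: "bij_betw (\<lambda>x. opposite (rot x)) darts darts"
proof (rule bij_betw_byWitness[where f' = "\<lambda>x. inv rot (opposite x)"])
  show "(\<lambda>x. opposite (rot x)) ` darts \<subseteq> darts"
    using rot_permutes opposite_darts permutes_in_image by fastforce
  show "(\<lambda>x. inv rot (opposite x)) ` darts \<subseteq> darts"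
    using permutes_inv[OF rot_permutes] opposite_darts permutes_in_image by fastforce
qed (simp_all add: permutes_inverses[OF rot_permutes])

lemma face_of_eq_iff:
  assumes "x \<in> darts" "y \<in> darts"
  shows "face_of rot x = face_of rot y \<longleftrightarrow> (\<exists>n. y = ((\<lambda>x. opposite (rot x)) ^^ n) x)"
proof -
  let ?f = "\<lambda>x. opposite (rot x)"
  have "inj ?f"
  proof (rule injI)
    fix y z assume "opposite (rot y) = opposite (rot z)"
    then have "rot y = rot z" by (metis opposite_opposite)
    then show "y = z" using permutes_inj[OF rot_permutes] by (simp add: injD)
  qed
  have self: "x \<in> orbit ?f x" if "x \<in> darts" for x
  proof -
    have "(?f ^^ n) x \<in> darts" for n
      by (induction n) (use that face_step_bij in \<open>auto simp: bij_betw_def\<close>)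
    then have "{y. \<exists>n. y = (?f ^^ n) x} \<subseteq> darts" by auto
    then have "finite {y. \<exists>n. y = (?f ^^ n) x}" using finite_darts finite_subset by blast
    then obtain n where "n > 0" "(?f ^^ n) x = x" using funpow_inj_finite[OF \<open>inj ?f\<close>] by blast
    then show ?thesis unfolding orbit_altdef by (auto intro!: exI[of _ n])
  qed
  have "(\<exists>n. y = (?f ^^ n) x) \<longleftrightarrow> y \<in> orbit ?f x"
  proof
    assume "\<exists>n. y = (?f ^^ n) x"
    then obtain n where n: "y = (?f ^^ n) x" by blast
    show "y \<in> orbit ?f x"
    proof (cases "n = 0")
      case True
      then show ?thesis using n self assms(1) by simp
    next
      case False
      then show ?thesis using n by (auto simp: orbit_altdef)
    qed
  qed (auto simp: orbit_altdef)
  also have "\<dots> \<longleftrightarrow> orbit ?f x = orbit ?f y"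
  proof
    assume y: "y \<in> orbit ?f x"
    have "x \<in> orbit ?f y" by (rule orbit_swap[OF self[OF assms(1)] y])
    then show "orbit ?f x = orbit ?f y" using y orbit_trans[of _ ?f x y] orbit_trans[of _ ?f y x] by blast
  qed (use self[OF assms(2)] in simp)
  finally show ?thesis unfolding face_of_def by blast
qed

lemma verts_connected:
  assumes "u \<in> W" "u \<in> verts G" "v \<in> verts G"
    and "\<And>e. e \<in> arcs G \<Longrightarrow> tail G e \<in> W \<longleftrightarrow> head G e \<in> W"
  shows "v \<in> W"
proof -
  have "(u, v) \<in> rtrancl_on (verts G) (\<Union>e\<in>arcs G. {(tail G e, head G e), (head G e, tail G e)})"
    using connected_graph assms(2,3)
    by (simp add: connected_def strongly_connected_def reachable_def parcs_mk_symmetric)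
  then show ?thesis by (induction rule: rtrancl_on_induct) (use assms in auto)
qed

sublocale surface: surface_map darts rot opposite "end_vertex G" "face_of rot"
proof
  show "bij_betw rot darts darts" by (rule permutes_imp_bij[OF rot_permutes])
  fix X assume X: "X \<subseteq> darts" "X \<noteq> {}" "\<And>x. x \<in> X \<Longrightarrow> rot x \<in> X" "\<And>x. x \<in> X \<Longrightarrow> opposite x \<in> X"
  have full: "y \<in> X" if xy: "x \<in> X" "y \<in> darts" "end_vertex G y = end_vertex G x" for x y
  proof -
    have "x \<in> darts" using xy(1) X(1) by blast
    then obtain n where "y = (rot ^^ n) x" using rot_eq_iff[of x y] xy(2,3) by auto
    moreover have "(rot ^^ n) x \<in> X" for n by (induction n) (use xy(1) X(3) in auto)
    ultimately show ?thesis by blast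
  qed
  let ?W = "end_vertex G ` X"
  have adj: "tail G e \<in> ?W \<longleftrightarrow> head G e \<in> ?W" if e: "e \<in> arcs G" for e
  proof
    assume "tail G e \<in> ?W"
    then have "Out e \<in> X" using full e by auto
    then have "In e \<in> X" using X(4) by fastforce
    then show "head G e \<in> ?W" by force
  next
    assume "head G e \<in> ?W"
    then have "In e \<in> X" using full e by auto
    then have "Out e \<in> X" using X(4) by fastforce
    then show "tail G e \<in> ?W" by force
  qed
  obtain x0 where x0: "x0 \<in> X" using X(2) by blast
  show "X = darts"
  proof
    show "darts \<subseteq> X"
    proof
      fix y assume y: "y \<in> darts"
      have "end_vertex G y \<in> ?W"
        by (rule verts_connected[of "end_vertex G x0"])
          (use x0 X(1) y end_vertex_in_verts adj in auto)
      then show "y \<in> X" using full y by force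
    qed
  qed (fact X(1))
qed (fact finite_darts face_step_bij opposite_darts opposite_opposite rot_eq_iff face_of_eq_iff)+

end

section \<open>Kauffman states and spanning arborescences\<close>

locale based_MOY_graph = plane_MOY_graph G rot c
  for G :: "('v, 'e) pre_digraph" and rot :: "'e edge_end \<Rightarrow> 'e edge_end" and c :: "'e \<Rightarrow> nat" +
  fixes e0 :: 'e
  assumes base: "base_edge G rot e0"
begin

abbreviation root_vertex where "root_vertex \<equiv> head G e0"
abbreviation states where "states \<equiv> Kauffman_states G rot e0"

lemma e0_arc: "e0 \<in> arcs G"
  and marked_distinct: "left_face e0 \<noteq> right_face e0"
  using base unfolding base_edge_def by auto

lemma faces_eq: "faces G rot = face_of rot ` darts"
  by (simp add: faces_def)

lemma root_vertex_in: "root_vertex \<in> verts G"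
  using e0_arc by simp

lemma vertices_have_darts: "end_vertex G ` darts = verts G"
proof
  show "end_vertex G ` darts \<subseteq> verts G" using end_vertex_in_verts by blast
  show "verts G \<subseteq> end_vertex G ` darts"
  proof
    have ends: "tail G e \<in> end_vertex G ` darts" "head G e \<in> end_vertex G ` darts" if "e \<in> arcs G" for e
      using that by (auto intro: rev_image_eqI[of "Out e"] rev_image_eqI[of "In e"])
    fix v assume "v \<in> verts G"
    then show "v \<in> end_vertex G ` darts"
      by (rule verts_connected[OF ends(2)[OF e0_arc] root_vertex_in]) (use ends in blast)
  qed
qed

text \<open>
  A spanning arborescence, directed away from the head of the base edge, is encoded by the edge into
  each vertex other than the root.
\<close>

definition arborescence :: "('v \<Rightarrow> 'e) \<Rightarrow> bool" where
  "arborescence t \<longleftrightarrow> (\<forall>v\<in>verts G - {root_vertex}. t v \<in> arcs G \<and> head G (t v) = v)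
    \<and> (\<exists>depth :: 'v \<Rightarrow> nat. \<forall>v\<in>verts G - {root_vertex}. depth (tail G (t v)) < depth v)"

definition circle_edge :: "('e \<Rightarrow> ('v, 'e) region) \<Rightarrow> 'v \<Rightarrow> 'e" where
  "circle_edge s v = inv_into (arcs G) s (Circle v)"

definition face_edge :: "('e \<Rightarrow> ('v, 'e) region) \<Rightarrow> 'e edge_end set \<Rightarrow> 'e" where
  "face_edge s f = inv_into (arcs G) s (Regular f)"

lemma regions_minus_marked:
  "regions G rot - marked_regions G rot e0
    = Circle ` verts G \<union> Regular ` (faces G rot - {left_face e0, right_face e0})"
  unfolding regions_def marked_regions_def by auto

lemma state_bij:
  assumes "s \<in> states"
  shows "bij_betw s (arcs G)
    (Circle ` verts G \<union> Regular ` (faces G rot - {left_face e0, right_face e0}))"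
  using assms unfolding Kauffman_states_def regions_minus_marked by blast

lemma state_inj: "s \<in> states \<Longrightarrow> inj_on s (arcs G)"
  using state_bij bij_betw_imp_inj_on by blast

lemma state_range:
  assumes "s \<in> states" "e \<in> arcs G"
  shows "(s e = Circle (head G e))
    \<or> (\<exists>f\<in>faces G rot - {left_face e0, right_face e0}. s e = Regular f \<and> (f = left_face e \<or> f = right_face e))"
proof -
  obtain k where k: "s e = corner_region G rot e k"
    using assms unfolding Kauffman_states_def by blast
  have "s e \<in> Circle ` verts G \<union> Regular ` (faces G rot - {left_face e0, right_face e0})"
    using bij_betw_apply[OF state_bij[OF assms(1)] assms(2)] .
  then show ?thesis using k by (cases k) auto
qed

lemma state_base: "s \<in> states \<Longrightarrow> s e0 = Circle root_vertex"
  using state_range[OF _ e0_arc] by auto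

lemma circle_edge:
  assumes s: "s \<in> states" and v: "v \<in> verts G"
  shows "circle_edge s v \<in> arcs G" "s (circle_edge s v) = Circle v" "head G (circle_edge s v) = v"
proof -
  have v': "Circle v \<in> s ` arcs G" using state_bij[OF s] v unfolding bij_betw_def by blast
  show 1: "circle_edge s v \<in> arcs G" unfolding circle_edge_def by (rule inv_into_into[OF v'])
  show 2: "s (circle_edge s v) = Circle v" unfolding circle_edge_def by (rule f_inv_into_f[OF v'])
  show "head G (circle_edge s v) = v" using state_range[OF s 1] 2 by auto
qed

lemma circle_edge_eqI:
  assumes "s \<in> states" "e \<in> arcs G" "s e = Circle v"
  shows "circle_edge s v = e"
  unfolding circle_edge_def using state_inj[OF assms(1)] assms(2,3) by (metis inv_into_f_f)

lemma circle_edge_root: "s \<in> states \<Longrightarrow> circle_edge s root_vertex = e0"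
  using circle_edge_eqI e0_arc state_base by blast

lemma face_edge:
  assumes s: "s \<in> states" and f: "f \<in> faces G rot - {left_face e0, right_face e0}"
  shows "face_edge s f \<in> arcs G" "s (face_edge s f) = Regular f"
    "left_face (face_edge s f) = f \<or> right_face (face_edge s f) = f"
proof -
  have f': "Regular f \<in> s ` arcs G" using state_bij[OF s] f unfolding bij_betw_def by blast
  show 1: "face_edge s f \<in> arcs G" unfolding face_edge_def by (rule inv_into_into[OF f'])
  show 2: "s (face_edge s f) = Regular f" unfolding face_edge_def by (rule f_inv_into_f[OF f'])
  show "left_face (face_edge s f) = f \<or> right_face (face_edge s f) = f"
    using state_range[OF s 1] 2 by auto
qed

lemma face_edge_eqI:
  assumes "s \<in> states" "e \<in> arcs G" "s e = Regular f"
  shows "face_edge s f = e"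
  unfolding face_edge_def using state_inj[OF assms(1)] assms(2,3) by (metis inv_into_f_f)

text \<open>
  In the tree of faces of a state, an unmarked face hangs on the edge whose crossing is sent to it.
  The right face of the base edge is the root, and the left one hangs on the base edge itself.
\<close>

definition face_parent :: "('e \<Rightarrow> ('v, 'e) region) \<Rightarrow> 'e edge_end set \<Rightarrow> 'e edge_end" where
  "face_parent s f = (let e = if f = left_face e0 then e0 else face_edge s f
    in if left_face e = f then Out e else In e)"

text \<open>
  The edges sent to circle regions and those sent to faces, with the base edge counted among the
  latter, are complementary choices for vertices and faces. The sector at the end of the base edge
  is at the root vertex and in the root face.
\<close>

lemma state_trees:
  assumes s: "s \<in> states"
  obtains depth codepth where
    "rooted_tree darts rot opposite (end_vertex G) (verts G) root_vertex (\<lambda>v. In (circle_edge s v)) depth"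
    "rooted_tree darts (\<lambda>x. opposite (rot x)) opposite (face_of rot) (faces G rot) (right_face e0)
      (face_parent s) codepth"
    "darts \<subseteq> parent_darts opposite (\<lambda>v. In (circle_edge s v)) (verts G - {root_vertex})
      \<union> parent_darts opposite (face_parent s) (faces G rot - {right_face e0})"
proof -
  let ?T = "parent_darts opposite (\<lambda>v. In (circle_edge s v)) (verts G - {root_vertex})"
  let ?T' = "parent_darts opposite (face_parent s) (faces G rot - {right_face e0})"
  have face_parent_in: "face_parent s f \<in> darts \<and> face_of rot (face_parent s f) = f"
    if "f \<in> faces G rot - {right_face e0}" for f
    using that e0_arc face_edge[OF s, of f] by (auto simp: face_parent_def Let_def)
  have cover: "x \<in> ?T \<union> ?T'" if x: "x = In e \<or> x = Out e" and e: "e \<in> arcs G" for x e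
  proof (cases "e = e0")
    case True
    have "left_face e0 \<in> faces G rot - {right_face e0}"
      using marked_distinct e0_arc by (auto simp: faces_eq)
    moreover have "face_parent s (left_face e0) = Out e0" by (simp add: face_parent_def)
    ultimately show ?thesis using x True unfolding parent_darts_def
      by (metis (mono_tags, lifting) UnI1 UnI2 image_eqI opposite.simps(1))
  next
    case False
    consider "s e = Circle (head G e)"
      | f where "f \<in> faces G rot - {left_face e0, right_face e0}" "s e = Regular f" "f = left_face e \<or> f = right_face e"
      using state_range[OF s e] by blast
    then show ?thesis
    proof cases
      case 1
      then have ce: "circle_edge s (head G e) = e" using circle_edge_eqI[OF s e] by simp
      then have "head G e \<noteq> root_vertex" using circle_edge_root[OF s] False by auto
      then have "head G e \<in> verts G - {root_vertex}" using e by simp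
      then have "In e \<in> ?T" "Out e \<in> ?T" unfolding parent_darts_def using ce
        by (force intro: rev_image_eqI)+
      then show ?thesis using x by blast
    next
      case 2
      then have "face_edge s f = e" using face_edge_eqI[OF s e] by simp
      then have "face_parent s f = Out e \<or> face_parent s f = In e" using 2(1)
        by (auto simp: face_parent_def Let_def)
      moreover have "f \<in> faces G rot - {right_face e0}" using 2(1) by blast
      ultimately show ?thesis using x unfolding parent_darts_def
        by (metis (mono_tags, lifting) UnI1 UnI2 image_eqI opposite.simps)
    qed
  qed
  have cover': "darts \<subseteq> ?T \<union> ?T'"
  proof
    fix x assume "x \<in> darts"
    then show "x \<in> ?T \<union> ?T'" using cover by (cases x) auto
  qed
  have "In e0 \<in> darts" using e0_arc by simp
  then obtain depth codepth where
    "rooted_tree darts rot opposite (end_vertex G) (end_vertex G ` darts) (end_vertex G (In e0))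
      (\<lambda>v. In (circle_edge s v)) depth"
    "rooted_tree darts (\<lambda>x. opposite (rot x)) opposite (face_of rot) (face_of rot ` darts) (right_face e0)
      (face_parent s) codepth"
    by (rule surface.complementary_parents_are_trees[of "In e0" "\<lambda>v. In (circle_edge s v)" "face_parent s"])
      (use circle_edge[OF s] face_parent_in cover' in \<open>simp_all add: vertices_have_darts flip: faces_eq\<close>)
  then show ?thesis using cover' vertices_have_darts faces_eq by (intro that) auto
qed

lemma state_arborescence:
  assumes s: "s \<in> states"
  shows "arborescence (circle_edge s)"
proof -
  obtain depth where "rooted_tree darts rot opposite (end_vertex G) (verts G) root_vertex (\<lambda>v. In (circle_edge s v)) depth"
    using state_trees[OF s] by blast
  then interpret rooted_tree darts rot opposite "end_vertex G" "verts G" root_vertex "\<lambda>v. In (circle_edge s v)" depth .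
  show ?thesis unfolding arborescence_def
    using circle_edge[OF s] parent by (auto intro!: exI[of _ depth])
qed

text \<open>
  The discrete form of the fact that the first homology of the sphere is zero.
\<close>

lemma flow_potential:
  fixes z :: "'e \<Rightarrow> int"
  assumes s: "s \<in> states"
    and flow: "\<And>v. v \<in> verts G \<Longrightarrow> (\<Sum>e\<in>in_arcs G v. z e) = (\<Sum>e\<in>out_arcs G v. z e)"
  obtains \<phi> where "\<And>e. e \<in> arcs G \<Longrightarrow> \<phi> (left_face e) - \<phi> (right_face e) = z e"
proof -
  define u where "u x = (case x of In e \<Rightarrow> z e | Out e \<Rightarrow> - z e)" for x
  obtain depth codepth where t:
    "rooted_tree darts rot opposite (end_vertex G) (verts G) root_vertex (\<lambda>v. In (circle_edge s v)) depth"
    "rooted_tree darts (\<lambda>x. opposite (rot x)) opposite (face_of rot) (faces G rot) (right_face e0)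
      (face_parent s) codepth"
    "darts \<subseteq> parent_darts opposite (\<lambda>v. In (circle_edge s v)) (verts G - {root_vertex})
      \<union> parent_darts opposite (face_parent s) (faces G rot - {right_face e0})"
    using state_trees[OF s] by blast
  have "\<exists>\<phi>. \<forall>x\<in>darts. u x = \<phi> (face_of rot (opposite x)) - \<phi> (face_of rot x)"
  proof (rule surface.flow_has_potential)
    show "u (opposite x) = - u x" for x by (cases x) (auto simp: u_def)
    fix k assume "k \<in> end_vertex G ` darts"
    then have k: "k \<in> verts G" by (simp add: vertices_have_darts)
    have "(\<Sum>x\<in>{x \<in> darts. end_vertex G x = k}. u x) = (\<Sum>x\<in>in_ends G k. u x) + (\<Sum>x\<in>out_ends G k. u x)"
      unfolding darts_at[symmetric]
      by (intro sum.union_disjoint) (auto simp: in_ends_def out_ends_def)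
    also have "\<dots> = 0"
      using flow[OF k] by (simp add: in_ends_def out_ends_def sum.reindex inj_on_def u_def sum_negf)
    finally show "(\<Sum>x\<in>{x \<in> darts. end_vertex G x = k}. u x) = 0" .
  qed (use t in \<open>simp_all add: vertices_have_darts flip: faces_eq\<close>)
  then obtain \<phi> where \<phi>: "\<And>x. x \<in> darts \<Longrightarrow> u x = \<phi> (face_of rot (opposite x)) - \<phi> (face_of rot x)" by blast
  show ?thesis
  proof (rule that)
    fix e assume "e \<in> arcs G"
    then show "\<phi> (left_face e) - \<phi> (right_face e) = z e" using \<phi>[of "In e"] by (simp add: u_def)
  qed
qed

end

fun edge_of :: "'e edge_end \<Rightarrow> 'e" where
  "edge_of (Out e) = e"
| "edge_of (In e) = e"

lemma edge_of_eq_iff: "edge_of x = edge_of y \<longleftrightarrow> x = y \<or> x = opposite y"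
  by (cases x; cases y) auto

context based_MOY_graph
begin

lemma edge_of_darts: "x \<in> darts \<Longrightarrow> edge_of x \<in> arcs G"
  by (cases x) auto

text \<open>
  A tree of faces in the complement of the arborescence directs every unmarked face to an edge next
  to it, and no edge is hit twice. That all the remaining edges are hit is Euler's formula.
\<close>

lemma arborescence_state:
  assumes t: "arborescence t"
  obtains s where "s \<in> states" "\<And>v. v \<in> verts G - {root_vertex} \<Longrightarrow> circle_edge s v = t v"
proof -
  obtain depth :: "'v \<Rightarrow> nat" where depth: "\<And>v. v \<in> verts G - {root_vertex} \<Longrightarrow> depth (tail G (t v)) < depth v"
    using t unfolding arborescence_def by blast
  have tv: "t v \<in> arcs G" "head G (t v) = v" if "v \<in> verts G - {root_vertex}" for v
    using t that unfolding arborescence_def by auto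
  note vd = vertices_have_darts
  have tree: "rooted_tree darts rot opposite (end_vertex G) (end_vertex G ` darts) (end_vertex G (In e0)) (\<lambda>v. In (t v)) depth"
  proof
    show "end_vertex G (In e0) \<in> end_vertex G ` darts" using root_vertex_in vd by simp
    fix v assume "v \<in> end_vertex G ` darts - {end_vertex G (In e0)}"
    then have v: "v \<in> verts G - {root_vertex}" using vd by simp
    show "In (t v) \<in> darts \<and> end_vertex G (In (t v)) = v \<and> end_vertex G (opposite (In (t v))) \<in> end_vertex G ` darts
        \<and> depth (end_vertex G (opposite (In (t v)))) < depth v"
      using tv[OF v] depth[OF v] vd by simp
  qed
  let ?F = "faces G rot - {left_face e0, right_face e0}"
  let ?T = "parent_darts opposite (\<lambda>v. In (t v)) (end_vertex G ` darts - {end_vertex G (In e0)})"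
  obtain coparent codepth where cotree: "rooted_tree darts (\<lambda>x. opposite (rot x)) opposite (face_of rot) (face_of rot ` darts)
      (right_face e0) coparent codepth"
    and off: "\<And>f. f \<in> face_of rot ` darts - {right_face e0} \<Longrightarrow> coparent f \<notin> ?T"
    using surface.tree_has_cotree[OF tree] e0_arc by auto
  interpret c: rooted_tree darts "\<lambda>x. opposite (rot x)" opposite "face_of rot" "face_of rot ` darts" "right_face e0" coparent codepth
    by fact
  have coparent: "coparent f \<in> darts" "face_of rot (coparent f) = f" "codepth (face_of rot (opposite (coparent f))) < codepth f"
    if "f \<in> ?F" for f
  proof -
    have "f \<in> face_of rot ` darts - {right_face e0}" using that unfolding faces_eq by blast
    from c.parent[OF this] show "coparent f \<in> darts" "face_of rot (coparent f) = f"
      "codepth (face_of rot (opposite (coparent f))) < codepth f" by blast+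
  qed
  have dpar_t: "edge_of (coparent f) \<noteq> t v" if f: "f \<in> ?F" and v: "v \<in> verts G - {root_vertex}" for f v
  proof
    assume "edge_of (coparent f) = t v"
    then have "coparent f = In (t v) \<or> coparent f = opposite (In (t v))" by (cases "coparent f") auto
    then have "coparent f \<in> ?T" using v vd unfolding parent_darts_def by auto
    moreover have "f \<in> face_of rot ` darts - {right_face e0}" using f unfolding faces_eq by blast
    ultimately show False using off by blast
  qed
  have dpar_e0: "edge_of (coparent f) \<noteq> e0" if f: "f \<in> ?F" for f
  proof
    assume "edge_of (coparent f) = e0"
    then have "coparent f = In e0 \<or> coparent f = Out e0" by (cases "coparent f") auto
    then have "f = right_face e0 \<or> f = left_face e0" using coparent(2)[OF f] by metis
    then show False using f by blast
  qed
  \<comment> \<open>The inverse of the state: from regions to crossings.\<close>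
  define g where "g \<rho> = (case \<rho> of Circle v \<Rightarrow> (if v = root_vertex then e0 else t v) | Regular f \<Rightarrow> edge_of (coparent f))"
    for \<rho> :: "('v, 'e) region"
  let ?A = "Circle ` verts G \<union> Regular ` ?F"
  have g_Circle: "g (Circle v) \<in> arcs G" "head G (g (Circle v)) = v" if "v \<in> verts G" for v
    using that tv e0_arc by (auto simp: g_def)
  have g_Regular: "g (Regular f) \<in> arcs G" if "f \<in> ?F" for f
    using coparent(1)[OF that] edge_of_darts by (simp add: g_def)
  have inj_F: "f = f'" if f: "f \<in> ?F" "f' \<in> ?F" and eq: "edge_of (coparent f) = edge_of (coparent f')" for f f'
  proof (rule ccontr)
    assume "f \<noteq> f'"
    then have "coparent f \<noteq> coparent f'" using coparent(2) f by metis
    then have "coparent f = opposite (coparent f')" using eq edge_of_eq_iff by blast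
    then have "opposite (coparent f) = coparent f'" by simp
    then have "codepth f' < codepth f" using coparent(3)[OF f(1)] coparent(2)[OF f(2)] by simp
    moreover have "codepth f < codepth f'"
      using coparent(3)[OF f(2)] coparent(2)[OF f(1)] \<open>coparent f = opposite (coparent f')\<close> by simp
    ultimately show False by simp
  qed
  have inj: "inj_on g ?A"
  proof (rule inj_onI)
    fix \<rho> \<rho>' assume \<rho>: "\<rho> \<in> ?A" "\<rho>' \<in> ?A" "g \<rho> = g \<rho>'"
    have CR: False if "v \<in> verts G" "f \<in> ?F" "g (Circle v) = g (Regular f)" for v f
      using that dpar_t[of f v] dpar_e0[of f] by (auto simp: g_def split: if_splits)
    show "\<rho> = \<rho>'"
    proof (cases \<rho>)
      case (Circle v)
      then have v: "v \<in> verts G" using \<rho> by auto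
      show ?thesis
      proof (cases \<rho>')
        case (Circle v')
        then have "v' \<in> verts G" using \<rho> by auto
        then show ?thesis using g_Circle(2) v \<rho>(3) \<open>\<rho> = Circle v\<close> Circle by metis
      next
        case (Regular f)
        then have "f \<in> ?F" using \<rho>(2) by blast
        then show ?thesis using CR[of v f] v \<rho>(3) \<open>\<rho> = Circle v\<close> Regular by simp
      qed
    next
      case (Regular f)
      then have f: "f \<in> ?F" using \<rho> by auto
      show ?thesis
      proof (cases \<rho>')
        case (Circle v)
        then have "v \<in> verts G" using \<rho>(2) by blast
        then show ?thesis using CR[of v f] f \<rho>(3) \<open>\<rho> = Regular f\<close> Circle by simp
      next
        case (Regular f')
        then have f': "f' \<in> ?F" using \<rho>(2) by blast
        have "edge_of (coparent f) = edge_of (coparent f')"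
          using \<rho>(3) \<open>\<rho> = Regular f\<close> Regular by (simp add: g_def)
        then show ?thesis using inj_F[OF f f'] \<open>\<rho> = Regular f\<close> Regular by simp
      qed
    qed
  qed
  have finF: "finite (faces G rot)" using finite_darts by (simp add: faces_eq)
  have "card ?A = card (verts G) + card ?F"
    using finF by (subst card_Un_disjoint) (auto simp: card_image inj_on_def)
  also have "card ?F = card (faces G rot) - 2"
    using marked_distinct e0_arc finF by (subst card_Diff_subset) (auto simp: faces_eq)
  also have "card (faces G rot) \<ge> 2"
    using card_mono[OF finF, of "{left_face e0, right_face e0}"] marked_distinct e0_arc by (auto simp: faces_eq)
  then have "card (verts G) + (card (faces G rot) - 2) = card (arcs G)"
    using plane e0_arc unfolding genus_zero_def by auto
  finally have "card ?A = card (arcs G)" .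
  moreover have "g ` ?A \<subseteq> arcs G" using g_Circle(1) g_Regular by auto
  ultimately have "g ` ?A = arcs G"
    using inj by (intro card_subset_eq) (auto simp: card_image)
  then have bij: "bij_betw g ?A (arcs G)" using inj by (simp add: bij_betw_def)
  define s where "s = restrict (inv_into ?A g) (arcs G)"
  have s_bij: "bij_betw s (arcs G) ?A"
  proof -
    have "bij_betw s (arcs G) ?A \<longleftrightarrow> bij_betw (inv_into ?A g) (arcs G) ?A"
      by (rule bij_betw_cong) (simp only: s_def restrict_apply if_True)
    then show ?thesis using bij_betw_inv_into[OF bij] by blast
  qed
  have s_g: "s (g \<rho>) = \<rho>" if "\<rho> \<in> ?A" for \<rho>
    using bij_betw_inv_into_left[OF bij that] bij_betw_apply[OF bij that]
    by (simp only: s_def restrict_apply if_True)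
  have corner: "\<exists>k. s e = corner_region G rot e k" if e: "e \<in> arcs G" for e
  proof -
    have "e \<in> g ` ?A" using e \<open>g ` ?A = arcs G\<close> by simp
    then obtain \<rho> where \<rho>: "\<rho> \<in> ?A" "g \<rho> = e" by (elim imageE) metis
    then have se: "s e = \<rho>" using s_g[OF \<rho>(1)] by simp
    from \<rho>(1) show ?thesis
    proof
      assume "\<rho> \<in> Circle ` verts G"
      then have "s e = corner_region G rot e North" using se \<rho>(2) g_Circle(2) by auto
      then show ?thesis by blast
    next
      assume "\<rho> \<in> Regular ` ?F"
      then obtain f where f: "f \<in> ?F" "\<rho> = Regular f" by blast
      then have "edge_of (coparent f) = e" using \<rho>(2) by (simp add: g_def)
      then have "coparent f = Out e \<or> coparent f = In e" by (cases "coparent f") auto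
      then have "f = left_face e \<or> f = right_face e" using coparent(2)[OF f(1)] by metis
      then have "s e = corner_region G rot e West \<or> s e = corner_region G rot e East" using se f by auto
      then show ?thesis by blast
    qed
  qed
  have "s \<in> extensional (arcs G)" by (simp add: s_def)
  then have "s \<in> states"
    unfolding Kauffman_states_def regions_minus_marked using s_bij corner by blast
  moreover have "circle_edge s v = t v" if v: "v \<in> verts G - {root_vertex}" for v
  proof (rule circle_edge_eqI[OF \<open>s \<in> states\<close> tv(1)[OF v]])
    have "Circle v \<in> ?A" "g (Circle v) = t v" using v by (auto simp: g_def)
    then show "s (t v) = Circle v" using s_g by metis
  qed
  ultimately show ?thesis by (rule that)
qed

end

section \<open>Heights of faces and levels of edges\<close>

context plane_MOY_graph
begin

text \<open>
  The edges into a vertex from left to right; neighbours bound a common sector. This is the form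
  in which the transverse orientation is used.
\<close>

definition fan :: "'v \<Rightarrow> nat \<Rightarrow> (nat \<Rightarrow> 'e) \<Rightarrow> bool" where
  "fan v n E \<longleftrightarrow> in_arcs G v = E ` {..<n}
    \<and> (\<forall>k. Suc k < n \<longrightarrow> right_face (E k) = left_face (E (Suc k)))"

lemma fan_exists:
  assumes "v \<in> verts G"
  shows "\<exists>n E. fan v n E"
proof -
  obtain x n where xn: "in_ends G v = (\<lambda>k. (rot ^^ k) x) ` {..<n}"
    using transverse_in[OF assms] unfolding consecutive_def by blast
  have "\<exists>e. e \<in> in_arcs G v \<and> (rot ^^ k) x = In e" if "k < n" for k
  proof -
    have "(rot ^^ k) x \<in> in_ends G v" using xn that by blast
    then show ?thesis unfolding in_ends_def by blast
  qed
  then obtain E where E: "\<And>k. k < n \<Longrightarrow> E k \<in> in_arcs G v \<and> (rot ^^ k) x = In (E k)" by metis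
  have "fan v n E" unfolding fan_def
  proof (intro conjI allI impI)
    show "in_arcs G v = E ` {..<n}"
    proof
      show "in_arcs G v \<subseteq> E ` {..<n}"
      proof
        fix e assume "e \<in> in_arcs G v"
        then have "In e \<in> (\<lambda>k. (rot ^^ k) x) ` {..<n}" unfolding xn[symmetric] in_ends_def by blast
        then obtain k where "k < n" "In e = (rot ^^ k) x" by blast
        then show "e \<in> E ` {..<n}" using E by auto
      qed
    qed (use E in auto)
    fix k assume k: "Suc k < n"
    then have "rot (In (E k)) = In (E (Suc k))" using E[of k] E[of "Suc k"] by simp
    moreover have "In (E k) \<in> darts" using E[of k] k by simp
    ultimately show "right_face (E k) = left_face (E (Suc k))"
      using surface.face_flip_turn[of "In (E k)"] by simp
  qed
  then show ?thesis by blast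
qed

text \<open>
  Being balanced, the coloring is a flow, and a height is a potential of it that increases from left
  to right. An edge \<open>e\<close> thus occupies the interval of the integers between the heights of its two
  sides, which has \<open>c e\<close> elements.
\<close>

definition is_height :: "('e edge_end set \<Rightarrow> int) \<Rightarrow> bool" where
  "is_height h \<longleftrightarrow> (\<forall>e\<in>arcs G. h (right_face e) - h (left_face e) = int (c e))"

definition carries :: "('e edge_end set \<Rightarrow> int) \<Rightarrow> 'e \<Rightarrow> int \<Rightarrow> bool" where
  "carries h e i \<longleftrightarrow> h (left_face e) \<le> i \<and> i < h (right_face e)"

text \<open>
  From left to right, the intervals of the edges into a vertex follow each other without gaps and
  without overlaps. So a level at the vertex determines the edge that carries it, and the levels that
  are carried form an interval.
\<close>

lemma fan_height_mono:
  assumes h: "is_height h" and fan: "fan v n E"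
  shows "i < j \<Longrightarrow> j < n \<Longrightarrow> h (right_face (E i)) \<le> h (left_face (E j))"
proof (induction j)
  case (Suc j)
  have "E j \<in> in_arcs G v" using fan Suc.prems unfolding fan_def by auto
  then have "h (left_face (E j)) \<le> h (right_face (E j))"
    using h unfolding is_height_def by fastforce
  moreover have "right_face (E j) = left_face (E (Suc j))" using fan Suc.prems unfolding fan_def by blast
  ultimately show ?case using Suc by (cases "i = j") auto
qed simp

lemma carries_unique:
  assumes h: "is_height h" and "v \<in> verts G" "e \<in> in_arcs G v" "e' \<in> in_arcs G v"
    and "carries h e i" "carries h e' i"
  shows "e = e'"
proof -
  obtain n E where fan: "fan v n E" using fan_exists[OF assms(2)] by blast
  then have E: "in_arcs G v = E ` {..<n}"
    "\<And>k. Suc k < n \<Longrightarrow> right_face (E k) = left_face (E (Suc k))"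
    unfolding fan_def by auto
  obtain a b where ab: "a < n" "b < n" "e = E a" "e' = E b" using assms(3,4) E(1) by auto
  have "\<not> a < b" "\<not> b < a"
    using fan_height_mono[OF h fan, of a b] fan_height_mono[OF h fan, of b a] ab assms(5,6)
    unfolding carries_def by force+
  then show ?thesis using ab by auto
qed

lemma carries_between:
  assumes h: "is_height h" and "v \<in> verts G" "e \<in> in_arcs G v" "e' \<in> in_arcs G v"
    and "carries h e i" "carries h e' j" "i \<le> m" "m \<le> j"
  obtains f where "f \<in> in_arcs G v" "carries h f m"
proof -
  obtain n E where fan: "fan v n E" using fan_exists[OF assms(2)] by blast
  then have E: "in_arcs G v = E ` {..<n}"
    "\<And>k. Suc k < n \<Longrightarrow> right_face (E k) = left_face (E (Suc k))"
    unfolding fan_def by auto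
  obtain a b where ab: "a < n" "b < n" "e = E a" "e' = E b" using assms(3,4) E(1) by auto
  define k where "k = (LEAST k. m < h (right_face (E k)))"
  have ex: "m < h (right_face (E b))" using ab assms(6,8) unfolding carries_def by simp
  then have k: "m < h (right_face (E k))" "k \<le> b" unfolding k_def by (fact LeastI, fact Least_le)
  have sub: "E ` {..<n} \<subseteq> arcs G" using E(1)[symmetric] by auto
  have "h (left_face (E k)) \<le> m"
  proof (cases k)
    case 0
    have "h (left_face (E 0)) \<le> h (left_face (E a))"
    proof (cases "a = 0")
      case False
      have "E 0 \<in> arcs G" using sub ab(1) by auto
      then have "h (left_face (E 0)) \<le> h (right_face (E 0))" using h unfolding is_height_def by fastforce
      then show ?thesis using fan_height_mono[OF h fan, of 0 a] ab False by force
    qed simp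
    then show ?thesis using 0 assms(5,7) ab unfolding carries_def by simp
  next
    case (Suc k')
    then have "\<not> m < h (right_face (E k'))" using not_less_Least[of k' "\<lambda>k. m < h (right_face (E k))"]
      unfolding k_def by simp
    then show ?thesis using E(2)[of k'] Suc k(2) ab by simp
  qed
  then show ?thesis using that[of "E k"] k ab E(1) unfolding carries_def by auto
qed

text \<open>
  The function \<open>\<psi>\<close> stands for the winding number of a closed curve that enters the vertex \<open>v\<close>
  through \<open>f\<close> and passes through no other edge into \<open>v\<close>. Edges into \<open>v\<close> to the left and to the right of \<open>f\<close>
  lie on different sides of the curve.
\<close>

lemma jump_separates:
  fixes \<psi> :: "'e edge_end set \<Rightarrow> int"
  assumes h: "is_height h" and "v \<in> verts G"
    and e: "e \<in> in_arcs G v" "e' \<in> in_arcs G v" "f \<in> in_arcs G v" "f \<noteq> e" "f \<noteq> e'"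
    and lev: "carries h e i" "carries h e' j" "carries h f m" "i \<le> m" "m \<le> j"
    and flat: "\<And>e. e \<in> in_arcs G v \<Longrightarrow> e \<noteq> f \<Longrightarrow> \<psi> (left_face e) = \<psi> (right_face e)"
    and jump: "\<psi> (left_face f) \<noteq> \<psi> (right_face f)"
  shows "\<psi> (left_face e) \<noteq> \<psi> (left_face e')"
proof -
  obtain n E where fan: "fan v n E" using fan_exists[OF assms(2)] by blast
  then have E: "in_arcs G v = E ` {..<n}"
    "\<And>k. Suc k < n \<Longrightarrow> right_face (E k) = left_face (E (Suc k))"
    unfolding fan_def by auto
  note mono = fan_height_mono[OF h fan]
  obtain a b d where ab: "a < n" "b < n" "d < n" "e = E a" "e' = E b" "f = E d" using e E(1) by auto
  have "\<not> d < a" "\<not> b < d" using mono[of d a] mono[of b d] ab lev unfolding carries_def by force+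
  then have order: "a < d" "d < b" using e(4,5) ab by (metis linorder_cases)+
  have notf: "E k \<noteq> f" if "k < n" "k \<noteq> d" for k
    using mono[of k d] mono[of d k] that ab lev(3) unfolding carries_def by (metis linorder_neqE_nat not_le order_le_less_trans)
  have along: "\<psi> (right_face (E k)) = \<psi> (left_face (E l))"
    if "k < l" "l < n" "\<And>q. k < q \<Longrightarrow> q < l \<Longrightarrow> q \<noteq> d" for k l
    using that
  proof (induction l)
    case (Suc l)
    show ?case
    proof (cases "k = l")
      case False
      then have "\<psi> (right_face (E k)) = \<psi> (left_face (E l))" using Suc by simp
      also have "\<dots> = \<psi> (right_face (E l))"
        using flat[of "E l"] notf[of l] Suc.prems False E(1) by auto
      finally show ?thesis using E(2)[of l] Suc.prems by simp
    qed (use E(2)[of l] Suc.prems in simp)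
  qed simp
  have "\<psi> (right_face e) = \<psi> (left_face f)" using along[of a d] order ab by simp
  moreover have "\<psi> (right_face f) = \<psi> (left_face e')" using along[of d b] order ab by simp
  ultimately show ?thesis using flat[OF e(1)] e(4) jump by auto
qed

end

section \<open>Moving one level at a time\<close>

context based_MOY_graph
begin

definition tree_rel :: "('v \<Rightarrow> 'e) \<Rightarrow> ('v \<times> 'v) set" where
  "tree_rel t = {(v, tail G (t v)) | v. v \<in> verts G - {root_vertex}}"

lemma tree_rel_iff: "(v, w) \<in> tree_rel t \<longleftrightarrow> v \<in> verts G - {root_vertex} \<and> w = tail G (t v)"
  unfolding tree_rel_def by blast

lemma tree_rel_start: "(v, w) \<in> (tree_rel t)\<^sup>* \<Longrightarrow> v \<noteq> w \<Longrightarrow> v \<in> verts G - {root_vertex} \<and> (tail G (t v), w) \<in> (tree_rel t)\<^sup>*"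
  by (erule converse_rtranclE) (auto simp: tree_rel_iff)

lemma arborescence_edge:
  assumes "arborescence t" "v \<in> verts G - {root_vertex}"
  shows "t v \<in> arcs G" "head G (t v) = v" "tail G (t v) \<in> verts G" "t v \<in> in_arcs G v"
  using assms unfolding arborescence_def by auto

lemma tree_rel_depth:
  assumes "\<And>v. v \<in> verts G - {root_vertex} \<Longrightarrow> depth (tail G (t v)) < (depth v :: nat)"
    and "(w, v) \<in> (tree_rel t)\<^sup>*"
  shows "depth v \<le> depth w"
  using assms(2)
proof (induction rule: converse_rtrancl_induct)
  case (step x y)
  then have "depth y < depth x" using assms(1)[of x] by (auto simp: tree_rel_iff)
  then show ?case using step.IH by simp
qed simp

lemma arborescence_acyclic:
  assumes "arborescence t" "v \<in> verts G - {root_vertex}"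
  shows "(tail G (t v), v) \<notin> (tree_rel t)\<^sup>*"
proof
  obtain depth :: "'v \<Rightarrow> nat" where depth: "\<And>v. v \<in> verts G - {root_vertex} \<Longrightarrow> depth (tail G (t v)) < depth v"
    using assms(1) unfolding arborescence_def by blast
  assume "(tail G (t v), v) \<in> (tree_rel t)\<^sup>*"
  then have "depth v \<le> depth (tail G (t v))" by (rule tree_rel_depth[rotated]) (rule depth)
  then show False using depth[OF assms(2)] by simp
qed

lemma indicator_flow:
  assumes "a \<in> arcs G"
  shows "(\<Sum>e\<in>in_arcs G w. of_bool (e = a)) = (of_bool (w = head G a) :: int)"
    "(\<Sum>e\<in>out_arcs G w. of_bool (e = a)) = (of_bool (w = tail G a) :: int)"
proof -
  have "finite (in_arcs G w)" "finite (out_arcs G w)"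
    by (rule finite_subset[of _ "arcs G"], auto)+
  then show "(\<Sum>e\<in>in_arcs G w. of_bool (e = a)) = (of_bool (w = head G a) :: int)"
    "(\<Sum>e\<in>out_arcs G w. of_bool (e = a)) = (of_bool (w = tail G a) :: int)"
    using assms unfolding of_bool_def by (auto simp: sum.delta)
qed

text \<open>
  The unit flow along the tree path from \<open>v\<close> down to its descendant \<open>u\<close>, as an integer function on
  edges. Its support is described by the vertices that the path enters, which exclude \<open>v\<close>.
\<close>

lemma path_flow:
  assumes t: "arborescence t" and "(u, v) \<in> (tree_rel t)\<^sup>*"
  shows "\<exists>z :: 'e \<Rightarrow> int.
    (\<forall>w. (\<Sum>e\<in>in_arcs G w. z e) - (\<Sum>e\<in>out_arcs G w. z e) = of_bool (w = u) - of_bool (w = v)) \<and>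
    (\<forall>e. z e \<noteq> 0 \<longrightarrow> (\<exists>w. (u, w) \<in> (tree_rel t)\<^sup>* \<and> (w, v) \<in> (tree_rel t)\<^sup>* \<and> w \<noteq> v \<and> e = t w))"
  using assms(2)
proof (induction rule: converse_rtrancl_induct)
  case base
  show ?case by (rule exI[of _ "\<lambda>_. 0"]) simp
next
  case (step u u')
  obtain z :: "'e \<Rightarrow> int" where z:
    "\<And>w. (\<Sum>e\<in>in_arcs G w. z e) - (\<Sum>e\<in>out_arcs G w. z e) = of_bool (w = u') - of_bool (w = v)"
    "\<And>e. z e \<noteq> 0 \<Longrightarrow> \<exists>w. (u', w) \<in> (tree_rel t)\<^sup>* \<and> (w, v) \<in> (tree_rel t)\<^sup>* \<and> w \<noteq> v \<and> e = t w"
    using step.IH by blast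
  have u: "u \<in> verts G - {root_vertex}" "u' = tail G (t u)" using step.hyps(1) by (auto simp: tree_rel_iff)
  note tu = arborescence_edge[OF t u(1)]
  have "u \<noteq> v" using arborescence_acyclic[OF t u(1)] step.hyps(2) u(2) by blast
  let ?z = "\<lambda>e. z e + of_bool (e = t u)"
  have "(\<Sum>e\<in>in_arcs G w. of_bool (e = t u)) = (of_bool (w = u) :: int)"
    "(\<Sum>e\<in>out_arcs G w. of_bool (e = t u)) = (of_bool (w = u') :: int)" for w
    using indicator_flow[OF tu(1)] tu(2) u(2) by simp_all
  then have "(\<Sum>e\<in>in_arcs G w. ?z e) - (\<Sum>e\<in>out_arcs G w. ?z e) = of_bool (w = u) - of_bool (w = v)" for w
    using z(1)[of w] by (simp add: sum.distrib)
  moreover have "\<exists>w. (u, w) \<in> (tree_rel t)\<^sup>* \<and> (w, v) \<in> (tree_rel t)\<^sup>* \<and> w \<noteq> v \<and> e = t w" if "?z e \<noteq> 0" for e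
  proof (cases "e = t u")
    case True
    then show ?thesis using \<open>u \<noteq> v\<close> step.hyps by (intro exI[of _ u]) auto
  next
    case False
    then have "z e \<noteq> 0" using that by simp
    then show ?thesis using z(2) step.hyps(1) by (meson converse_rtrancl_into_rtrancl)
  qed
  ultimately show ?case by blast
qed

text \<open>
  If the new edge into \<open>v\<close> does not start at a descendant of \<open>v\<close>, a depth function for the new choice
  is obtained by pushing all descendants of \<open>v\<close> down far enough.
\<close>

lemma reroute_arborescence:
  assumes t: "arborescence t" and v: "v \<in> verts G - {root_vertex}" and f: "f \<in> in_arcs G v"
    and nd: "(tail G f, v) \<notin> (tree_rel t)\<^sup>*"
  shows "arborescence (t(v := f))"
proof -
  obtain depth :: "'v \<Rightarrow> nat" where depth: "\<And>v. v \<in> verts G - {root_vertex} \<Longrightarrow> depth (tail G (t v)) < depth v"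
    using t unfolding arborescence_def by blast
  define depth' where "depth' w = (if (w, v) \<in> (tree_rel t)\<^sup>* then depth w + depth (tail G f) + 1 else depth w)" for w
  have "depth' (tail G ((t(v := f)) w)) < depth' w" if w: "w \<in> verts G - {root_vertex}" for w
  proof (cases "w = v")
    case True
    then show ?thesis using nd by (simp add: depth'_def)
  next
    case False
    have "(w, v) \<in> (tree_rel t)\<^sup>* \<longleftrightarrow> (tail G (t w), v) \<in> (tree_rel t)\<^sup>*"
      using tree_rel_start[OF _ False] w by (auto simp: tree_rel_iff intro: converse_rtrancl_into_rtrancl)
    then show ?thesis using False depth[OF w] by (simp add: depth'_def)
  qed
  moreover have "(t(v := f)) w \<in> arcs G \<and> head G ((t(v := f)) w) = w" if "w \<in> verts G - {root_vertex}" for w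
    using arborescence_edge[OF t that] f by auto
  ultimately show ?thesis unfolding arborescence_def by blast
qed

text \<open>
  Here \<open>f\<close> closes the tree path from \<open>v\<close> to its start to a directed cycle with vertex set \<open>C\<close>, and
  \<open>\<psi>\<close> is the winding number of the cycle: a potential of the unit flow along it. This replaces the
  Jordan curve theorem. Around vertices off the cycle, and along edges between them, \<open>\<psi>\<close> does not
  change. If an arborescence \<open>t'\<close> contains the path, then no ancestor of \<open>v\<close> in \<open>t'\<close> is on the cycle,
  since it would also be a descendant of \<open>v\<close>. So \<open>\<psi>\<close> has the same value along the edge of \<open>t'\<close> into \<open>v\<close>
  as at the root.
\<close>

lemma cycle_separates:
  fixes t v f
  defines "C \<equiv> {w. (tail G f, w) \<in> (tree_rel t)\<^sup>* \<and> (w, v) \<in> (tree_rel t)\<^sup>*}"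
  assumes t: "arborescence t" and v: "v \<in> verts G - {root_vertex}" and f: "f \<in> in_arcs G v"
    and desc: "(tail G f, v) \<in> (tree_rel t)\<^sup>*"
  obtains \<psi> :: "'e edge_end set \<Rightarrow> int" where
    "\<psi> (left_face f) \<noteq> \<psi> (right_face f)"
    "\<And>e. e \<in> in_arcs G v \<Longrightarrow> e \<noteq> f \<Longrightarrow> \<psi> (left_face e) = \<psi> (right_face e)"
    "\<And>t'. arborescence t' \<Longrightarrow> (\<And>w. w \<in> C - {v} \<Longrightarrow> t' w = t w) \<Longrightarrow>
      t' v \<noteq> f \<and> \<psi> (left_face (t' v)) = \<psi> (right_face e0)"
proof -
  let ?R = "tree_rel t"
  let ?u = "tail G f"
  obtain s where s: "s \<in> states" using arborescence_state[OF t] by blast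
  obtain z :: "'e \<Rightarrow> int" where z:
    "\<And>w. (\<Sum>e\<in>in_arcs G w. z e) - (\<Sum>e\<in>out_arcs G w. z e) = of_bool (w = ?u) - of_bool (w = v)"
    "\<And>e. z e \<noteq> 0 \<Longrightarrow> \<exists>w. (?u, w) \<in> ?R\<^sup>* \<and> (w, v) \<in> ?R\<^sup>* \<and> w \<noteq> v \<and> e = t w"
    using path_flow[OF t desc] by blast
  have z_supp: "\<exists>w\<in>C - {v}. e = t w" if "z e \<noteq> 0" for e
    using z(2)[OF that] unfolding C_def by blast
  have C_inner: "w \<in> verts G - {root_vertex}" "tail G (t w) \<in> C" if "w \<in> C - {v}" for w
    using that tree_rel_start[of w v t] unfolding C_def
    by (auto simp: tree_rel_iff intro: rtrancl_into_rtrancl)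
  have vC: "v \<in> C" and uC: "?u \<in> C" using desc unfolding C_def by auto
  have rC: "root_vertex \<notin> C" using C_inner(1)[of root_vertex] v by blast
  have z_in: "z e = 0" if "e \<in> in_arcs G v" for e
  proof (rule ccontr)
    assume "z e \<noteq> 0"
    then obtain w where w: "w \<in> C - {v}" "e = t w" using z_supp by blast
    then show False using arborescence_edge(2)[OF t C_inner(1)[OF w(1)]] that by simp
  qed
  let ?z = "\<lambda>e. z e + of_bool (e = f)"
  have "(\<Sum>e\<in>in_arcs G w. of_bool (e = f)) = (of_bool (w = v) :: int)"
    "(\<Sum>e\<in>out_arcs G w. of_bool (e = f)) = (of_bool (w = ?u) :: int)" for w
    using indicator_flow[of f] f by simp_all
  then have "(\<Sum>e\<in>in_arcs G w. ?z e) = (\<Sum>e\<in>out_arcs G w. ?z e)" for w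
    using z(1)[of w] by (simp add: sum.distrib)
  then obtain \<psi> where \<psi>: "\<And>e. e \<in> arcs G \<Longrightarrow> \<psi> (left_face e) - \<psi> (right_face e) = ?z e"
    using flow_potential[OF s, of ?z] by blast
  have away: "\<psi> (left_face e) = \<psi> (right_face e)" if e: "e \<in> arcs G" "head G e \<notin> C \<or> tail G e \<notin> C" for e
  proof -
    have "e \<noteq> f" using e vC uC f by auto
    moreover have "z e = 0"
    proof (rule ccontr)
      assume "z e \<noteq> 0"
      then obtain w where w: "w \<in> C - {v}" "e = t w" using z_supp by blast
      then show False using e C_inner[OF w(1)] arborescence_edge[OF t C_inner(1)[OF w(1)]] by auto
    qed
    ultimately show ?thesis using \<psi>[OF e(1)] by simp
  qed
  have around: "\<psi> (face_of rot y) = \<psi> (face_of rot x)"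
    if "x \<in> darts" "end_vertex G x = w" "y \<in> darts" "end_vertex G y = w" "w \<notin> C" for x y w
  proof (rule surface.eq_on_cell[OF _ that(1-4), where f = "\<lambda>x. \<psi> (face_of rot x)"])
    fix y assume y: "y \<in> darts" "end_vertex G y = w"
    have ry: "rot y \<in> darts" "end_vertex G (rot y) = w"
      using surface.turn_in[OF y(1)] surface.cell_turn[OF y(1)] y(2) by auto
    have "\<psi> (face_of rot (opposite (rot y))) = \<psi> (face_of rot (rot y))"
      using ry that(5) away by (cases "rot y") auto
    then show "\<psi> (face_of rot (rot y)) = \<psi> (face_of rot y)"
      using surface.face_flip_turn[OF y(1)] by simp
  qed
  show ?thesis
  proof (rule that)
    show "\<psi> (left_face f) \<noteq> \<psi> (right_face f)" using \<psi>[of f] z_in[of f] f by auto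
    show "\<psi> (left_face e) = \<psi> (right_face e)" if "e \<in> in_arcs G v" "e \<noteq> f" for e
      using \<psi>[of e] z_in[of e] that by auto
  next
    fix t' assume t': "arborescence t'" and agree: "\<And>w. w \<in> C - {v} \<Longrightarrow> t' w = t w"
    obtain depth :: "'v \<Rightarrow> nat" where depth: "\<And>v. v \<in> verts G - {root_vertex} \<Longrightarrow> depth (tail G (t' v)) < depth v"
      using t' unfolding arborescence_def by blast
    note t'v = arborescence_edge[OF t' v]
    have to_v: "(w, v) \<in> (tree_rel t')\<^sup>*" if "w \<in> C" for w
    proof -
      have "(w, v) \<in> ?R\<^sup>*" "(?u, w) \<in> ?R\<^sup>*" using that unfolding C_def by auto
      then show ?thesis
      proof (induction rule: converse_rtrancl_induct)
        case (step x y)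
        show ?case
        proof (cases "x = v")
          case False
          have "(x, v) \<in> ?R\<^sup>*" using step.hyps by (rule converse_rtrancl_into_rtrancl)
          then have "t' x = t x" using agree step.prems False unfolding C_def by blast
          then have "(x, y) \<in> tree_rel t'" using step.hyps(1) by (simp add: tree_rel_iff)
          moreover have "(?u, y) \<in> ?R\<^sup>*" using step.prems step.hyps(1) by (rule rtrancl_into_rtrancl)
          ultimately show ?thesis using step.IH by (meson converse_rtrancl_into_rtrancl)
        qed simp
      qed simp
    qed
    have avoid: "w \<notin> C" if "(tail G (t' v), w) \<in> (tree_rel t')\<^sup>*" for w
      using to_v[of w] that arborescence_acyclic[OF t' v] by (meson rtrancl_trans)
    have "\<psi> (face_of rot x) = \<psi> (right_face e0)"
      if "(tail G (t' v), w) \<in> (tree_rel t')\<^sup>*" "w \<in> verts G" "x \<in> darts" "end_vertex G x = w" for w x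
      using that
    proof (induction "depth w" arbitrary: w x rule: less_induct)
      case less
      note wC = avoid[OF less.prems(1)]
      show ?case
      proof (cases "w = root_vertex")
        case True
        then show ?thesis using around[of "In e0" w x] less.prems wC e0_arc by simp
      next
        case False
        then have w: "w \<in> verts G - {root_vertex}" using less.prems by blast
        note tw = arborescence_edge[OF t' w]
        have "(w, tail G (t' w)) \<in> tree_rel t'" using w by (simp add: tree_rel_iff)
        then have "(tail G (t' v), tail G (t' w)) \<in> (tree_rel t')\<^sup>*"
          using less.prems(1) by (meson rtrancl_into_rtrancl)
        then have "\<psi> (left_face (t' w)) = \<psi> (right_face e0)"
          using less.hyps[OF depth[OF w], of "Out (t' w)"] tw by simp
        moreover have "\<psi> (left_face (t' w)) = \<psi> (right_face (t' w))" using away tw wC by simp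
        moreover have "\<psi> (face_of rot x) = \<psi> (right_face (t' w))"
          using around[of "In (t' w)" w x] tw less.prems wC by simp
        ultimately show ?thesis by simp
      qed
    qed
    from this[of "tail G (t' v)" "Out (t' v)"] have "\<psi> (left_face (t' v)) = \<psi> (right_face e0)"
      using t'v by simp
    moreover have "t' v \<noteq> f" using avoid[of "tail G (t' v)"] uC by auto
    ultimately show "t' v \<noteq> f \<and> \<psi> (left_face (t' v)) = \<psi> (right_face e0)" by simp
  qed
qed

text \<open>
  Levelings index the monomials of the state sum: the level at a vertex selects one of the terms of
  the quantum integer of the edge into it.
\<close>

definition leveling :: "('e edge_end set \<Rightarrow> int) \<Rightarrow> ('v \<Rightarrow> 'e) \<Rightarrow> ('v \<Rightarrow> int) \<Rightarrow> bool" where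
  "leveling h t l \<longleftrightarrow> arborescence t \<and> (\<forall>v\<in>verts G - {root_vertex}. carries h (t v) (l v))"

text \<open>
  Choose \<open>v\<close> deepest in \<open>t\<close> among the vertices where the levelings differ, and let \<open>f\<close> be the edge into
  \<open>v\<close> that carries the next level \<open>m\<close> towards \<open>l' v\<close>. If \<open>f\<close> came from a descendant of \<open>v\<close>, it would
  close a cycle with a path that belongs to both arborescences, because the two levelings agree below
  \<open>v\<close>. Then \<open>f\<close> differs from the edges of \<open>t\<close> and \<open>t'\<close> into \<open>v\<close>, and these are on different
  sides of \<open>f\<close>, so on different sides of the cycle. But both can be reached from the root without meeting the cycle before \<open>v\<close>.
\<close>

lemma exchange:
  assumes h: "is_height h" and tl: "leveling h t l" and tl': "leveling h t' l'"
    and differ: "\<exists>v\<in>verts G - {root_vertex}. l v \<noteq> l' v"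
  shows "\<exists>v\<in>verts G - {root_vertex}. \<exists>f. l v \<noteq> l' v \<and> leveling h (t(v := f)) (l(v := l v + sgn (l' v - l v)))"
proof -
  let ?R = "tree_rel t"
  have t: "arborescence t" and t': "arborescence t'" using tl tl' unfolding leveling_def by auto
  have car: "carries h (t v) (l v)" "carries h (t' v) (l' v)" if "v \<in> verts G - {root_vertex}" for v
    using tl tl' that unfolding leveling_def by auto
  obtain depth :: "'v \<Rightarrow> nat" where depth: "\<And>v. v \<in> verts G - {root_vertex} \<Longrightarrow> depth (tail G (t v)) < depth v"
    using t unfolding arborescence_def by blast
  let ?D = "{v \<in> verts G - {root_vertex}. l v \<noteq> l' v}"
  have D: "finite (depth ` ?D)" "depth ` ?D \<noteq> {}" using differ by auto
  obtain v where v: "v \<in> ?D" "depth v = Max (depth ` ?D)" using Max_in[OF D] by auto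
  have deepest: "depth w \<le> depth v" if "w \<in> ?D" for w
    using Max_ge[OF D(1)] that v(2) by simp
  have vr: "v \<in> verts G - {root_vertex}" and vv: "v \<in> verts G" and neq: "l v \<noteq> l' v" using v(1) by auto
  define m where "m = l v + sgn (l' v - l v)"
  have m: "l v < m \<and> m \<le> l' v \<or> l' v \<le> m \<and> m < l v"
    using neq unfolding m_def by (auto simp: sgn_if)
  have ins: "t v \<in> in_arcs G v" "t' v \<in> in_arcs G v"
    using arborescence_edge(4)[OF t vr] arborescence_edge(4)[OF t' vr] by auto
  obtain f where f: "f \<in> in_arcs G v" "carries h f m"
    using m carries_between[OF h vv ins car[OF vr], of m] carries_between[OF h vv ins(2,1) car(2,1)[OF vr], of m]
    by force
  have "(tail G f, v) \<notin> ?R\<^sup>*"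
  proof
    assume desc: "(tail G f, v) \<in> ?R\<^sup>*"
    have agree: "t' w = t w" if w: "(tail G f, w) \<in> ?R\<^sup>*" "(w, v) \<in> ?R\<^sup>*" "w \<noteq> v" for w
    proof -
      have wr: "w \<in> verts G - {root_vertex}" "(tail G (t w), v) \<in> ?R\<^sup>*"
        using tree_rel_start[OF w(2,3)] by auto
      have "depth v \<le> depth (tail G (t w))" by (rule tree_rel_depth[OF _ wr(2)]) (rule depth)
      then have "depth v < depth w" using depth[OF wr(1)] by simp
      then have "l w = l' w" using deepest[of w] wr(1) by force
      then show ?thesis
        using carries_unique[OF h _ arborescence_edge(4)[OF t' wr(1)] arborescence_edge(4)[OF t wr(1)]]
          car[OF wr(1)] wr(1) by auto
    qed
    obtain \<psi> :: "'e edge_end set \<Rightarrow> int" where \<psi>: "\<psi> (left_face f) \<noteq> \<psi> (right_face f)"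
      "\<And>e. e \<in> in_arcs G v \<Longrightarrow> e \<noteq> f \<Longrightarrow> \<psi> (left_face e) = \<psi> (right_face e)"
      "t v \<noteq> f" "\<psi> (left_face (t v)) = \<psi> (right_face e0)"
      "t' v \<noteq> f" "\<psi> (left_face (t' v)) = \<psi> (right_face e0)"
    proof (rule cycle_separates[OF t vr f(1) desc])
      fix \<psi> :: "'e edge_end set \<Rightarrow> int"
      assume a: "\<psi> (left_face f) \<noteq> \<psi> (right_face f)"
        "\<And>e. e \<in> in_arcs G v \<Longrightarrow> e \<noteq> f \<Longrightarrow> \<psi> (left_face e) = \<psi> (right_face e)"
        "\<And>t'. arborescence t' \<Longrightarrow>
          (\<And>w. w \<in> {w. (tail G f, w) \<in> ?R\<^sup>* \<and> (w, v) \<in> ?R\<^sup>*} - {v} \<Longrightarrow> t' w = t w) \<Longrightarrow>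
          t' v \<noteq> f \<and> \<psi> (left_face (t' v)) = \<psi> (right_face e0)"
      have "t v \<noteq> f \<and> \<psi> (left_face (t v)) = \<psi> (right_face e0)" by (rule a(3)[OF t refl])
      moreover have "t' v \<noteq> f \<and> \<psi> (left_face (t' v)) = \<psi> (right_face e0)"
        by (rule a(3)[OF t']) (use agree in blast)
      ultimately show thesis using that[OF a(1,2)] by blast
    qed
    from m show False
    proof
      assume "l v < m \<and> m \<le> l' v"
      then show False
        using jump_separates[OF h vv ins f(1) _ _ car[OF vr] f(2) _ _ \<psi>(2,1)] \<psi>(3-6) by auto
    next
      assume "l' v \<le> m \<and> m < l v"
      then show False
        using jump_separates[OF h vv ins(2,1) f(1) _ _ car(2,1)[OF vr] f(2) _ _ \<psi>(2,1)] \<psi>(3-6) by auto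
    qed
  qed
  then have "arborescence (t(v := f))" by (rule reroute_arborescence[OF t vr f(1)])
  then have "leveling h (t(v := f)) (l(v := m))"
    using car(1) f(2) unfolding leveling_def by auto
  then show ?thesis using vr neq unfolding m_def by blast
qed

end

section \<open>Coefficients of the state sum\<close>

lemma thalf_mult: "thalf a * thalf b = thalf (a + b)"
  unfolding thalf_def by (rule fls_X_intpow_times_fls_X_intpow)

lemma thalf_0: "thalf 0 = 1"
  by (simp add: thalf_def)

lemma thalf_nth: "fls_nth (thalf a) k = of_bool (k = a)"
  by (simp add: thalf_def)

lemma thalf_mult_nth: "fls_nth (thalf a * f) k = fls_nth f (k - a)"
  by (simp add: thalf_def fls_X_intpow_times_conv_shift(1))

lemma prod_thalf: "(\<Prod>x\<in>A. thalf (f x)) = thalf (\<Sum>x\<in>A. f x)"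
  by (induction A rule: infinite_finite_induct) (auto simp: thalf_0 thalf_mult)

text \<open>
  The quantum integer of a color is a sum over the levels of the edge, up to a power of \<open>t\<close> that
  depends on the sum of the heights of its sides only.
\<close>

lemma qint_shift:
  assumes "int i = b - a"
  shows "qint i = thalf (1 - a - b) * (\<Sum>m\<in>{a..<b}. thalf (2 * m))"
proof -
  define S where "S = (\<Sum>m\<in>{a..<b}. thalf (2 * m))"
  have telescope: "(thalf 1 - thalf (- 1)) * (\<Sum>m\<in>{a..<a + int n}. thalf (2 * m))
      = thalf (2 * (a + int n) - 1) - thalf (2 * a - 1)" for n
  proof (induction n)
    case (Suc n)
    have "{a..<a + int (Suc n)} = insert (a + int n) {a..<a + int n}" by auto
    then show ?case using Suc by (simp add: algebra_simps thalf_mult)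
  qed simp
  have "(thalf 1 - thalf (- 1)) * S = thalf (2 * b - 1) - thalf (2 * a - 1)"
    using telescope[of i] assms by (simp add: S_def)
  then have "(thalf 1 - thalf (- 1)) * (thalf (1 - a - b) * S)
      = thalf (1 - a - b) * (thalf (2 * b - 1) - thalf (2 * a - 1))"
    by (simp add: mult.left_commute)
  also have "\<dots> = thalf (int i) - thalf (- int i)"
  proof -
    have "1 - a - b + (2 * b - 1) = int i" "1 - a - b + (2 * a - 1) = - int i" using assms by simp_all
    then show ?thesis by (simp only: right_diff_distrib thalf_mult)
  qed
  finally have "thalf (int i) - thalf (- int i) = (thalf 1 - thalf (- 1)) * (thalf (1 - a - b) * S)" ..
  moreover have "thalf 1 - thalf (- 1) \<noteq> 0"
  proof
    assume "thalf 1 - thalf (- 1) = 0"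
    then have "fls_nth (thalf 1 - thalf (- 1)) 1 = 0" by simp
    then show False by (simp add: thalf_nth)
  qed
  ultimately show ?thesis unfolding qint_def S_def by simp
qed

context based_MOY_graph
begin

lemma height_exists:
  assumes "s \<in> states"
  obtains h where "is_height h"
proof -
  have bal: "(\<Sum>e\<in>in_arcs G v. - int (c e)) = (\<Sum>e\<in>out_arcs G v. - int (c e))" if "v \<in> verts G" for v
    using balanced[OF that] by (simp add: sum_negf flip: of_nat_sum)
  obtain h where h: "\<And>e. e \<in> arcs G \<Longrightarrow> h (left_face e) - h (right_face e) = - int (c e)"
    using flow_potential[OF assms bal] by blast
  have "h (right_face e) - h (left_face e) = int (c e)" if "e \<in> arcs G" for e
    using h[OF that] by simp
  then show ?thesis using that unfolding is_height_def by blast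
qed

definition levels :: "('e edge_end set \<Rightarrow> int) \<Rightarrow> 'e \<Rightarrow> int set" where
  "levels h e = {h (left_face e)..<h (right_face e)}"

lemma carries_iff: "carries h e i \<longleftrightarrow> i \<in> levels h e"
  by (simp add: carries_def levels_def)

text \<open>
  Let \<open>e\<close> differ from the base edge. With the heights of its two sides written as \<open>a\<close> and \<open>b\<close>, the
  west and the east corner contribute the powers of \<open>t\<close> with exponents \<open>a - (a + b) / 2\<close> and
  \<open>b - (a + b) / 2\<close>. So the contribution of the chosen region can be separated from a factor that does
  not depend on the state.
\<close>

lemma contribution_height:
  assumes h: "is_height h" and s: "s \<in> states" and e: "e \<in> arcs G"
  shows "contribution c e0 e (chosen_corner G rot s e)
    = (if e = e0 then thalf (int (c e0)) else thalf (- h (left_face e) - h (right_face e)))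
      * (case s e of Circle v \<Rightarrow> if v = root_vertex then 1
           else thalf 1 * (\<Sum>m\<in>levels h (circle_edge s v). thalf (2 * m))
         | Regular f \<Rightarrow> thalf (2 * h f))"
proof (cases "e = e0")
  case True
  then show ?thesis using state_base[OF s] by (simp add: contribution_def)
next
  case False
  have ce: "int (c e) = h (right_face e) - h (left_face e)" using h e unfolding is_height_def by simp
  consider "s e = Circle (head G e)" | f where "s e = Regular f" "f = left_face e \<or> f = right_face e"
    using state_range[OF s e] by blast
  then show ?thesis
  proof cases
    case 1
    then have "circle_edge s (head G e) = e" using circle_edge_eqI[OF s e] by blast
    moreover from this have "head G e \<noteq> root_vertex" using circle_edge_root[OF s] False by auto
    moreover have "chosen_corner G rot s e = North" using 1 by (simp add: chosen_corner_def)
    moreover have "qint (c e) = thalf (1 - h (left_face e) - h (right_face e)) * (\<Sum>m\<in>levels h e. thalf (2 * m))"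
      unfolding levels_def by (rule qint_shift[OF ce])
    ultimately show ?thesis
      using 1 False by (simp add: contribution_def mult.assoc[symmetric] thalf_mult algebra_simps)
  next
    case 2
    then show ?thesis
      using False ce by (auto simp: contribution_def chosen_corner_def thalf_mult)
  qed
qed

text \<open>
  A state uses every unmarked region exactly once, so the factors of the faces, too, multiply to the
  same power of \<open>t\<close> for all states.
\<close>

lemma state_weight_levels:
  assumes h: "is_height h"
  obtains K where "\<And>s. s \<in> states \<Longrightarrow> state_weight G rot c e0 s
    = thalf K * (\<Prod>v\<in>verts G - {root_vertex}. \<Sum>m\<in>levels h (circle_edge s v). thalf (2 * m))"
proof -
  let ?F = "faces G rot - {left_face e0, right_face e0}"
  let ?V = "verts G - {root_vertex}"
  let ?A = "Circle ` verts G \<union> Regular ` ?F"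
  define K where "K = (\<Sum>e\<in>arcs G. if e = e0 then int (c e0) else - h (left_face e) - h (right_face e))
    + int (card ?V) + (\<Sum>f\<in>?F. 2 * h f)"
  show ?thesis
  proof (rule that)
    fix s assume s: "s \<in> states"
    define B where "B \<rho> = (case \<rho> of Circle v \<Rightarrow> if v = root_vertex then 1
           else thalf 1 * (\<Sum>m\<in>levels h (circle_edge s v). thalf (2 * m))
         | Regular f \<Rightarrow> thalf (2 * h f))" for \<rho> :: "('v, 'e) region"
    have "state_weight G rot c e0 s
      = (\<Prod>e\<in>arcs G. thalf (if e = e0 then int (c e0) else - h (left_face e) - h (right_face e)) * B (s e))"
      unfolding state_weight_def B_def using contribution_height[OF h s] by (intro prod.cong) auto
    also have "\<dots> = thalf (\<Sum>e\<in>arcs G. if e = e0 then int (c e0) else - h (left_face e) - h (right_face e))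
        * (\<Prod>e\<in>arcs G. B (s e))"
      by (simp only: prod.distrib prod_thalf)
    also have "(\<Prod>e\<in>arcs G. B (s e)) = (\<Prod>\<rho>\<in>?A. B \<rho>)"
      by (rule prod.reindex_bij_betw[OF state_bij[OF s]])
    also have "\<dots> = (\<Prod>\<rho>\<in>Circle ` verts G. B \<rho>) * (\<Prod>\<rho>\<in>Regular ` ?F. B \<rho>)"
      using finite_darts by (intro prod.union_disjoint) (auto simp: faces_eq)
    also have "(\<Prod>\<rho>\<in>Regular ` ?F. B \<rho>) = thalf (\<Sum>f\<in>?F. 2 * h f)"
      by (simp add: prod.reindex inj_on_def B_def prod_thalf)
    also have "(\<Prod>\<rho>\<in>Circle ` verts G. B \<rho>) = (\<Prod>v\<in>verts G. B (Circle v))"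
      by (simp add: prod.reindex inj_on_def)
    also have "\<dots> = B (Circle root_vertex) * (\<Prod>v\<in>?V. B (Circle v))"
      using root_vertex_in by (subst prod.remove[of _ root_vertex]) auto
    also have "\<dots> = (\<Prod>v\<in>?V. thalf 1 * (\<Sum>m\<in>levels h (circle_edge s v). thalf (2 * m)))"
      by (simp add: B_def)
    also have "\<dots> = thalf (int (card ?V)) * (\<Prod>v\<in>?V. \<Sum>m\<in>levels h (circle_edge s v). thalf (2 * m))"
      by (simp only: prod.distrib prod_thalf) simp
    finally show "state_weight G rot c e0 s
        = thalf K * (\<Prod>v\<in>?V. \<Sum>m\<in>levels h (circle_edge s v). thalf (2 * m))"
      unfolding K_def by (simp add: thalf_mult[symmetric] mult_ac)
  qed
qed

lemma finite_states: "finite states"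
proof (rule finite_subset)
  show "states \<subseteq> (\<Pi>\<^sub>E e\<in>arcs G. Circle ` verts G \<union> Regular ` faces G rot)"
  proof
    fix s assume s: "s \<in> states"
    have "s e \<in> Circle ` verts G \<union> Regular ` faces G rot" if "e \<in> arcs G" for e
      using bij_betw_apply[OF state_bij[OF s] that] by blast
    moreover have "s \<in> extensional (arcs G)" using s unfolding Kauffman_states_def by blast
    ultimately show "s \<in> (\<Pi>\<^sub>E e\<in>arcs G. Circle ` verts G \<union> Regular ` faces G rot)"
      by (simp add: PiE_iff)
  qed
  show "finite (\<Pi>\<^sub>E e\<in>arcs G. Circle ` verts G \<union> Regular ` faces G rot)"
    using finite_darts by (intro finite_PiE) (auto simp: faces_eq)
qed

definition total_level :: "('v \<Rightarrow> int) \<Rightarrow> int" where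
  "total_level l = (\<Sum>v\<in>verts G - {root_vertex}. l v)"

lemma Alexander_coeff:
  assumes h: "is_height h"
  obtains K where "\<And>k. fls_nth (Alexander G rot c e0) k \<ge> 0"
    "\<And>k. fls_nth (Alexander G rot c e0) k \<noteq> 0 \<longleftrightarrow> (\<exists>t l. leveling h t l \<and> k = K + 2 * total_level l)"
proof -
  let ?V = "verts G - {root_vertex}"
  let ?P = "\<lambda>s. \<Pi>\<^sub>E v\<in>?V. levels h (circle_edge s v)"
  obtain K where K: "\<And>s. s \<in> states \<Longrightarrow> state_weight G rot c e0 s
    = thalf K * (\<Prod>v\<in>?V. \<Sum>m\<in>levels h (circle_edge s v). thalf (2 * m))"
    using state_weight_levels[OF h] by blast
  have finP: "finite (?P s)" for s by (intro finite_PiE) (auto simp: levels_def)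
  have w: "state_weight G rot c e0 s = (\<Sum>l\<in>?P s. thalf (K + 2 * total_level l))" if "s \<in> states" for s
  proof -
    have "(\<Prod>v\<in>?V. \<Sum>m\<in>levels h (circle_edge s v). thalf (2 * m)) = (\<Sum>l\<in>?P s. \<Prod>v\<in>?V. thalf (2 * l v))"
      by (rule prod_sum_PiE) (auto simp: levels_def)
    also have "\<dots> = (\<Sum>l\<in>?P s. thalf (2 * total_level l))"
      by (simp add: prod_thalf total_level_def sum_distrib_left)
    finally show ?thesis using K[OF that] by (simp add: sum_distrib_left thalf_mult)
  qed
  define Q where "Q = Sigma states ?P"
  have finQ: "finite Q" unfolding Q_def using finite_states finP by (intro finite_SigmaI)
  have "Alexander G rot c e0 = (\<Sum>s\<in>states. \<Sum>l\<in>?P s. thalf (K + 2 * total_level l))"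
    unfolding Alexander_def using w by (intro sum.cong) auto
  also have "\<dots> = (\<Sum>(s, l)\<in>Q. thalf (K + 2 * total_level l))"
    unfolding Q_def using finite_states finP by (intro sum.Sigma) auto
  finally have coeff: "fls_nth (Alexander G rot c e0) k = (\<Sum>q\<in>Q. of_bool (k = K + 2 * total_level (snd q)))" for k
    by (simp add: fls_nth_sum thalf_nth case_prod_unfold)
  show ?thesis
  proof (rule that)
    show "fls_nth (Alexander G rot c e0) k \<ge> 0" for k
      unfolding coeff by (intro sum_nonneg) auto
    fix k
    have "fls_nth (Alexander G rot c e0) k \<noteq> 0 \<longleftrightarrow> (\<exists>q\<in>Q. k = K + 2 * total_level (snd q))"
      unfolding coeff using finQ by (subst sum_nonneg_eq_0_iff) auto
    also have "\<dots> \<longleftrightarrow> (\<exists>t l. leveling h t l \<and> k = K + 2 * total_level l)"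
    proof
      assume "\<exists>q\<in>Q. k = K + 2 * total_level (snd q)"
      then obtain s l where sl: "s \<in> states" "l \<in> ?P s" "k = K + 2 * total_level l" unfolding Q_def by auto
      have "leveling h (circle_edge s) l"
        unfolding leveling_def carries_iff using state_arborescence[OF sl(1)] sl(2) by (auto simp: PiE_iff)
      then show "\<exists>t l. leveling h t l \<and> k = K + 2 * total_level l" using sl(3) by blast
    next
      assume "\<exists>t l. leveling h t l \<and> k = K + 2 * total_level l"
      then obtain t l where tl: "leveling h t l" "k = K + 2 * total_level l" by blast
      then have "arborescence t" and lev: "\<And>v. v \<in> ?V \<Longrightarrow> l v \<in> levels h (t v)"
        unfolding leveling_def carries_iff by auto
      then obtain s where s: "s \<in> states" "\<And>v. v \<in> ?V \<Longrightarrow> circle_edge s v = t v"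
        using arborescence_state by blast
      have "(s, restrict l ?V) \<in> Q" unfolding Q_def using s lev by (auto simp: PiE_iff)
      moreover have "total_level (restrict l ?V) = total_level l" unfolding total_level_def by (intro sum.cong) auto
      ultimately show "\<exists>q\<in>Q. k = K + 2 * total_level (snd q)" using tl(2) by force
    qed
    finally show "fls_nth (Alexander G rot c e0) k \<noteq> 0 \<longleftrightarrow> (\<exists>t l. leveling h t l \<and> k = K + 2 * total_level l)" .
  qed
qed

text \<open>
  Moving \<open>l\<close> towards \<open>l'\<close> by \<open>exchange\<close> changes the total by one in each step, so no value is skipped.
\<close>

lemma total_intermediate:
  assumes h: "is_height h" and "leveling h t l" and l': "leveling h t' l'"
    and "total_level l \<le> j" "j \<le> total_level l'"
  shows "\<exists>t l. leveling h t l \<and> total_level l = j"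
  using assms(2,4)
proof (induction "\<Sum>v\<in>verts G - {root_vertex}. nat \<bar>l v - l' v\<bar>" arbitrary: t l rule: less_induct)
  case less
  let ?V = "verts G - {root_vertex}"
  show ?case
  proof (cases "total_level l = j")
    case True
    then show ?thesis using less.prems by blast
  next
    case False
    then have "total_level l < total_level l'" using less.prems assms(5) by simp
    then have "\<exists>v\<in>?V. l v \<noteq> l' v" unfolding total_level_def by (metis (no_types, lifting) less_irrefl sum.cong)
    then obtain v f where v: "v \<in> ?V" "l v \<noteq> l' v"
      and new: "leveling h (t(v := f)) (l(v := l v + sgn (l' v - l v)))" (is "leveling h _ ?l")
      using exchange[OF h less.prems(1) l'] by blast
    have "total_level ?l = total_level l + sgn (l' v - l v)"
      unfolding total_level_def using v(1) by (simp add: sum.remove[of ?V v])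
    then have "total_level ?l \<le> j" using False less.prems(2) by (auto simp: sgn_if split: if_splits)
    moreover have "(\<Sum>w\<in>?V. nat \<bar>?l w - l' w\<bar>) < (\<Sum>w\<in>?V. nat \<bar>l w - l' w\<bar>)"
      using v by (intro sum_strict_mono_ex1) (auto simp: sgn_if intro!: bexI[of _ v])
    ultimately show ?thesis using less.hyps new by blast
  qed
qed

end

theorem theorem1p1:
  fixes G :: "('v, 'e) pre_digraph"
    and rot :: "'e edge_end \<Rightarrow> 'e edge_end"
    and c :: "'e \<Rightarrow> nat"
    and e0 :: 'e
    and n :: nat
    and a :: "nat \<Rightarrow> rat"
  assumes "plane_MOY_graph G rot c"
    and "base_edge G rot e0"
    and "n \<ge> 1"
    and "Alexander G rot c e0 \<doteq> (\<Sum>i=1..n. fls_const (a i) * thalf (2 * int i))"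
    and "a 1 = a n"
    and "a n \<noteq> 0"
  shows "\<forall>i\<in>{1..n}. a i > 0"
proof
  interpret plane_MOY_graph G rot c by fact
  interpret based_MOY_graph G rot c e0 by unfold_locales fact
  let ?\<Delta> = "Alexander G rot c e0"
  obtain m where m: "?\<Delta> = thalf m * (\<Sum>i=1..n. fls_const (a i) * thalf (2 * int i))"
    using assms(4) unfolding eq_up_to_power_def by blast
  have coeff: "fls_nth ?\<Delta> (m + 2 * int i) = a i" if "i \<in> {1..n}" for i
  proof -
    have "fls_nth ?\<Delta> (m + 2 * int i) = (\<Sum>j=1..n. a j * of_bool (2 * int i = 2 * int j))"
      unfolding m thalf_mult_nth by (simp add: fls_nth_sum thalf_nth)
    also have "\<dots> = (\<Sum>j=1..n. if i = j then a j else 0)" by (intro sum.cong) auto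
    also have "\<dots> = a i" using that by simp
    finally show ?thesis .
  qed
  have ends: "fls_nth ?\<Delta> (m + 2 * int 1) \<noteq> 0" "fls_nth ?\<Delta> (m + 2 * int n) \<noteq> 0"
    using coeff[of 1] coeff[of n] assms(3,5,6) by auto
  then have "states \<noteq> {}" unfolding Alexander_def by auto
  then obtain h where h: "is_height h" using height_exists by blast
  obtain K where nonneg: "\<And>k. fls_nth ?\<Delta> k \<ge> 0"
    and supp: "\<And>k. fls_nth ?\<Delta> k \<noteq> 0 \<longleftrightarrow> (\<exists>t l. leveling h t l \<and> k = K + 2 * total_level l)"
    using Alexander_coeff[OF h] by blast
  obtain t l t' l' where l: "leveling h t l" "m + 2 * int 1 = K + 2 * total_level l"
    and l': "leveling h t' l'" "m + 2 * int n = K + 2 * total_level l'"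
    using ends supp by metis
  fix i assume i: "i \<in> {1..n}"
  have "total_level l \<le> total_level l + int i - 1" "total_level l + int i - 1 \<le> total_level l'"
    using i l(2) l'(2) by auto
  then obtain t'' l'' where "leveling h t'' l''" "total_level l'' = total_level l + int i - 1"
    using total_intermediate[OF h l(1) l'(1)] by blast
  moreover have "m + 2 * int i = K + 2 * (total_level l + int i - 1)" using l(2) by simp
  ultimately have "fls_nth ?\<Delta> (m + 2 * int i) \<noteq> 0" using supp by metis
  then show "a i > 0" using nonneg[of "m + 2 * int i"] coeff[OF i] by simp
qed

end
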